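(* (Positive part.) Let $\mathcal{G},\mathcal{H}$ be graph classes such that $\mathcal{G}$ is hereditary and there is a graph $M$ such that every graph in $\mathcal{H}$ is $M$-minor-free. Then $\mathcal{H}$ is $(\operatorname{ic}_g^{\mathcal{G}},\operatorname{c}_g^{\mathcal{G}})$-bounded. (Negative part.) In each of the following two cases there exist graph classes $\mathcal{G},\mathcal{H}$ with the listed properties such that $\mathcal{H}$ is not $(\operatorname{ic}_g^{\mathcal{G}},\operatorname{c}_g^{\mathcal{G}})$-bounded: 1. $\mathcal{G}$ is monotone and both $\mathcal{G}$ and $\mathcal{H}$ have bounded maximum average degree. 2. $\mathcal{G}$ is component-closed and $\mathcal{H}$ has bounded treewidth.
   Context: Graphs are finite and simple; graph classes are closed under isomorphism. A $\mathcal{G}$-cover of a graph $H$ is a graph homomorphism $\varphi\colon G_1\sqcup\dots\sqcup G_t\to H$ (disjoint union) with $G_i\in\mathcal{G}$ for all $i$, such that every edge of $H$ is the image of some edge. It is injective if each $G_i$ is isomorphic via $\varphi$ to its image $\varphi(G_i)\subseteq H$; it is induced if each image $\varphi(G_i)$ is an induced subgraph of $H$. The global covering number $\operatorname{c}_g^{\mathcal{G}}(H)$ is the smallest $t$ such that $H$ has an injective $\mathcal{G}$-cover with $t$ guests $G_1,\dots,G_t$. The global-induced covering number $\operatorname{ic}_g^{\mathcal{G}}(H)$ is the smallest $t$ such that $H$ has an injective induced $\mathcal{G}$-cover with $t$ guests. Each is $\infty$ if no such cover exists. A graph class $\mathcal{H}$ is $(\operatorname{ic}_g^{\mathcal{G}},\operatorname{c}_g^{\mathcal{G}})$-bounded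 if there is a function $f\colon\mathbb{N}\to\mathbb{N}$ with $\operatorname{ic}_g^{\mathcal{G}}(H)\le f(\operatorname{c}_g^{\mathcal{G}}(H))$ for every $H\in\mathcal{H}$ (the inequality being required only when $\operatorname{c}_g^{\mathcal{G}}(H)<\infty$). A class is component-closed if it contains every connected component of each of its members, hereditary if closed under induced subgraphs, monotone if closed under subgraphs. The maximum average degree of $G$ is $\operatorname{mad}(G)=\max\{2|E(G')|/|V(G')| : G'\subseteq G,\ |V(G')|\ge 1\}$. A parameter $p$ is bounded on a class $\mathcal{Q}$ if $\sup_{G\in\mathcal{Q}}p(G)<\infty$. *)

theory Defs
  imports Complex_Main "HOL-Library.Extended_Nat"
begin

section \<open>Finite simple graphs\<close>

record 'a ugraph =
  verts :: "'a set"
  edges :: "'a set set"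

definition simple_graph :: "'a ugraph \<Rightarrow> bool" where
  "simple_graph G \<longleftrightarrow> finite (verts G) \<and> (\<forall>e\<in>edges G. e \<subseteq> verts G \<and> card e = 2)"

definition subgraph :: "'a ugraph \<Rightarrow> 'a ugraph \<Rightarrow> bool" where
  "subgraph K G \<longleftrightarrow> simple_graph K \<and> verts K \<subseteq> verts G \<and> edges K \<subseteq> edges G"

definition induce :: "'a ugraph \<Rightarrow> 'a set \<Rightarrow> 'a ugraph" where
  "induce G S = \<lparr>verts = S, edges = {e \<in> edges G. e \<subseteq> S}\<rparr>"

definition induced_subgraph :: "'a ugraph \<Rightarrow> 'a ugraph \<Rightarrow> bool" where
  "induced_subgraph K G \<longleftrightarrow> verts K \<subseteq> verts G \<and> K = induce G (verts K)"

definition graph_hom :: "('a \<Rightarrow> 'b) \<Rightarrow> 'a ugraph \<Rightarrow> 'b ugraph \<Rightarrow> bool" where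
  "graph_hom \<phi> G H \<longleftrightarrow> \<phi> ` verts G \<subseteq> verts H \<and> (\<forall>e\<in>edges G. \<phi> ` e \<in> edges H)"

definition iso_via :: "('a \<Rightarrow> 'b) \<Rightarrow> 'a ugraph \<Rightarrow> 'b ugraph \<Rightarrow> bool" where
  "iso_via \<phi> G H \<longleftrightarrow> bij_betw \<phi> (verts G) (verts H) \<and>
     (\<forall>u\<in>verts G. \<forall>v\<in>verts G. {u, v} \<in> edges G \<longleftrightarrow> {\<phi> u, \<phi> v} \<in> edges H)"

definition isomorphic :: "'a ugraph \<Rightarrow> 'b ugraph \<Rightarrow> bool" where
  "isomorphic G H \<longleftrightarrow> (\<exists>\<phi>. iso_via \<phi> G H)"

definition image_graph :: "('a \<Rightarrow> 'b) \<Rightarrow> 'a ugraph \<Rightarrow> 'b ugraph" where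
  "image_graph \<phi> G = \<lparr>verts = \<phi> ` verts G, edges = (\<lambda>e. \<phi> ` e) ` edges G\<rparr>"

definition disjoint_union :: "'a ugraph list \<Rightarrow> (nat \<times> 'a) ugraph" where
  "disjoint_union Gs =
     \<lparr>verts = {(i, v). i < length Gs \<and> v \<in> verts (Gs ! i)},
      edges = {Pair i ` e | i e. i < length Gs \<and> e \<in> edges (Gs ! i)}\<rparr>"

definition reachable :: "'a ugraph \<Rightarrow> 'a \<Rightarrow> 'a \<Rightarrow> bool" where
  "reachable G u v \<longleftrightarrow> (u, v) \<in> {(x, y). {x, y} \<in> edges G}\<^sup>*"

definition connected_graph :: "'a ugraph \<Rightarrow> bool" where
  "connected_graph G \<longleftrightarrow> verts G \<noteq> {} \<and> (\<forall>u\<in>verts G. \<forall>v\<in>verts G. reachable G u v)"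

definition components :: "'a ugraph \<Rightarrow> 'a ugraph set" where
  "components G = {induce G {u \<in> verts G. reachable G v u} | v. v \<in> verts G}"


section \<open>Graph classes\<close>

text \<open>Every finite graph is isomorphic to one whose vertices are natural numbers, so an
  isomorphism-closed class is determined by its members on natural numbers.\<close>

definition graph_class :: "nat ugraph set \<Rightarrow> bool" where
  "graph_class C \<longleftrightarrow> (\<forall>G\<in>C. simple_graph G) \<and>
     (\<forall>G\<in>C. \<forall>G'. simple_graph G' \<and> isomorphic G G' \<longrightarrow> G' \<in> C)"

definition component_closed :: "nat ugraph set \<Rightarrow> bool" where
  "component_closed C \<longleftrightarrow> (\<forall>G\<in>C. components G \<subseteq> C)"

definition hereditary :: "nat ugraph set \<Rightarrow> bool" where
  "hereditary C \<longleftrightarrow> (\<forall>G\<in>C. \<forall>K. induced_subgraph K G \<longrightarrow> K \<in> C)"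

definition monotone_class :: "nat ugraph set \<Rightarrow> bool" where
  "monotone_class C \<longleftrightarrow> (\<forall>G\<in>C. \<forall>K. subgraph K G \<longrightarrow> K \<in> C)"

definition param_bounded :: "(nat ugraph \<Rightarrow> 'b::linorder) \<Rightarrow> nat ugraph set \<Rightarrow> bool" where
  "param_bounded p C \<longleftrightarrow> bdd_above (p ` C)"


section \<open>Covers and covering numbers\<close>

definition cover :: "nat ugraph set \<Rightarrow> nat ugraph \<Rightarrow> nat ugraph list \<Rightarrow> (nat \<times> nat \<Rightarrow> nat) \<Rightarrow> bool"
where
  "cover \<G> H Gs \<phi> \<longleftrightarrow> set Gs \<subseteq> \<G> \<and> graph_hom \<phi> (disjoint_union Gs) H \<and>
     (\<forall>e\<in>edges H. \<exists>e'\<in>edges (disjoint_union Gs). e = \<phi> ` e')"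

definition injective_cover :: "nat ugraph list \<Rightarrow> (nat \<times> nat \<Rightarrow> nat) \<Rightarrow> bool" where
  "injective_cover Gs \<phi> \<longleftrightarrow> (\<forall>i<length Gs.
     iso_via (\<lambda>v. \<phi> (i, v)) (Gs ! i) (image_graph (\<lambda>v. \<phi> (i, v)) (Gs ! i)))"

definition induced_cover :: "nat ugraph \<Rightarrow> nat ugraph list \<Rightarrow> (nat \<times> nat \<Rightarrow> nat) \<Rightarrow> bool" where
  "induced_cover H Gs \<phi> \<longleftrightarrow> (\<forall>i<length Gs.
     induced_subgraph (image_graph (\<lambda>v. \<phi> (i, v)) (Gs ! i)) H)"

text \<open>In \<^typ>\<open>enat\<close> the infimum of the empty set is \<open>\<infinity>\<close>.\<close>

definition cg :: "nat ugraph set \<Rightarrow> nat ugraph \<Rightarrow> enat" where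
  "cg \<G> H = Inf {enat (length Gs) | Gs. \<exists>\<phi>. cover \<G> H Gs \<phi> \<and> injective_cover Gs \<phi>}"

definition icg :: "nat ugraph set \<Rightarrow> nat ugraph \<Rightarrow> enat" where
  "icg \<G> H = Inf {enat (length Gs) | Gs.
     \<exists>\<phi>. cover \<G> H Gs \<phi> \<and> injective_cover Gs \<phi> \<and> induced_cover H Gs \<phi>}"

definition icg_cg_bounded :: "nat ugraph set \<Rightarrow> nat ugraph set \<Rightarrow> bool" where
  "icg_cg_bounded \<G> \<H> \<longleftrightarrow>
     (\<exists>f :: nat \<Rightarrow> nat. \<forall>H\<in>\<H>. \<forall>t. cg \<G> H = enat t \<longrightarrow> icg \<G> H \<le> enat (f t))"


section \<open>Maximum average degree, minors, treewidth\<close>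

text \<open>The graph without vertices has maximum average degree 0 by convention.\<close>

definition mad :: "'a ugraph \<Rightarrow> real" where
  "mad G = (if verts G = {} then 0 else
     Max {2 * real (card (edges K)) / real (card (verts K)) | K.
            subgraph K G \<and> card (verts K) \<ge> 1})"

text \<open>\<open>B x\<close> is the branch set of \<open>x\<close>: the part of \<open>G\<close> that is contracted to \<open>x\<close>.\<close>

definition is_minor :: "'b ugraph \<Rightarrow> 'a ugraph \<Rightarrow> bool" where
  "is_minor M G \<longleftrightarrow> (\<exists>B :: 'b \<Rightarrow> 'a set.
     (\<forall>x\<in>verts M. B x \<subseteq> verts G \<and> connected_graph (induce G (B x))) \<and>
     (\<forall>x\<in>verts M. \<forall>y\<in>verts M. x \<noteq> y \<longrightarrow> B x \<inter> B y = {}) \<and>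
     (\<forall>x y. {x, y} \<in> edges M \<longrightarrow> (\<exists>u\<in>B x. \<exists>v\<in>B y. {u, v} \<in> edges G)))"

definition minor_free :: "'b ugraph \<Rightarrow> 'a ugraph \<Rightarrow> bool" where
  "minor_free M G \<longleftrightarrow> \<not> is_minor M G"

definition is_cycle :: "'a ugraph \<Rightarrow> 'a list \<Rightarrow> bool" where
  "is_cycle G vs \<longleftrightarrow> length vs \<ge> 3 \<and> distinct vs \<and> set vs \<subseteq> verts G \<and>
     (\<forall>i<length vs. {vs ! i, vs ! (Suc i mod length vs)} \<in> edges G)"

definition is_tree :: "'a ugraph \<Rightarrow> bool" where
  "is_tree T \<longleftrightarrow> simple_graph T \<and> connected_graph T \<and> (\<nexists>vs. is_cycle T vs)"

definition tree_decomposition :: "'a ugraph \<Rightarrow> nat ugraph \<Rightarrow> (nat \<Rightarrow> 'a set) \<Rightarrow> bool" where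
  "tree_decomposition G T X \<longleftrightarrow> is_tree T \<and>
     (\<Union>t\<in>verts T. X t) = verts G \<and>
     (\<forall>e\<in>edges G. \<exists>t\<in>verts T. e \<subseteq> X t) \<and>
     (\<forall>v\<in>verts G. connected_graph (induce T {t \<in> verts T. v \<in> X t}))"

text \<open>Truncated subtraction only affects the graph without vertices, which gets treewidth 0
  instead of \<open>-1\<close>.\<close>

definition decomposition_width :: "nat ugraph \<Rightarrow> (nat \<Rightarrow> 'a set) \<Rightarrow> nat" where
  "decomposition_width T X = Max ((\<lambda>t. card (X t)) ` verts T) - 1"

definition treewidth :: "'a ugraph \<Rightarrow> nat" where
  "treewidth G = (LEAST w. \<exists>T X. tree_decomposition G T X \<and> decomposition_width T X = w)"

end

theory Submission imports Defs begin

text \<open>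
  An injective cover of \<open>H\<close> is a list of subgraphs of \<open>H\<close> from \<open>\<G>\<close> that contain all edges
  (\<open>cg_le_iff\<close>, \<open>icg_le_iff\<close>), so the question is how many induced subgraphs are needed to replace
  one subgraph \<open>K\<close>.

  \<^bold>\<open>Hosts without a fixed minor.\<close> Take a star colouring of \<open>H\<close>: a proper colouring without
  two-coloured paths on four vertices. For two colours \<open>p\<close>, \<open>q\<close> let \<open>S\<close> be the set of endpoints of the
  \<open>K\<close>-edges with these colours. The colours \<open>p\<close>, \<open>q\<close> span a star forest in \<open>H\<close>, and each vertex of \<open>S\<close> keeps
  a \<open>K\<close>-edge of its star; hence \<open>K\<close> and \<open>H\<close> induce the same graph on \<open>S\<close> (\<open>bicoloured_part_induced\<close>).
  As \<open>\<G>\<close> is hereditary, \<open>K\<close> is replaced by at most \<open>k * k\<close> induced subgraphs, where \<open>k\<close> is the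
  number of colours.

  That boundedly many colours suffice (\<open>minor_free_star_colouring\<close>) rests on Mader's theorem
  that dense graphs have large clique minors (\<open>dense_graph_clique_minor\<close>). It makes \<open>H\<close>, and all minors
  of \<open>H\<close>, degenerate. Orient the edges of \<open>H\<close> along a degeneracy ranking; it is enough to colour
  properly the graph in which also the ends of directed paths of length two and any two
  out-neighbours of a common vertex are adjacent. The first kind of pairs is sparse because
  out-degrees are bounded; the second kind is sparse because contracting the common vertices
  turns many such pairs into edges of a minor of \<open>H\<close> (\<open>fraternal_sparse\<close>).

  \<^bold>\<open>Bounded maximum average degree.\<close> Let \<open>\<G>\<close> be the class of star forests. The graph obtained from
  a complete graph by subdividing each edge once is the union of two star forests. An induced
  subgraph containing two branch vertices and the vertex between them must contain both
  half-edges, and a pigeonhole argument forces arbitrarily many induced star forests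
  (\<open>icg_subdivided_complete\<close>).

  \<^bold>\<open>Bounded treewidth.\<close> Let \<open>\<G>\<close> consist of the paths on three vertices, which are connected, and
  let the hosts be triangles. Two paths cover a triangle, but no induced subgraph of a triangle
  is such a path, so the induced covering number is infinite (\<open>triangles_not_bounded\<close>).
\<close>

section \<open>Connectivity and minors\<close>

lemma reachable_refl: "reachable G u u"
  by (simp add: reachable_def)

lemma reachable_edge: "{u, v} \<in> edges G \<Longrightarrow> reachable G u v"
  by (auto simp: reachable_def)

lemma reachable_trans: "reachable G u v \<Longrightarrow> reachable G v w \<Longrightarrow> reachable G u w"
  by (auto simp: reachable_def)

lemma reachable_sym: "reachable G u v \<Longrightarrow> reachable G v u"
proof -
  have "sym {(x, y). {x, y} \<in> edges G}" by (auto simp: sym_def insert_commute)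
  then show "reachable G u v \<Longrightarrow> reachable G v u"
    unfolding reachable_def by (meson sym_rtrancl symD)
qed

lemma reachable_induce_mono:
  assumes "reachable (induce G S) u v" "S \<subseteq> S'"
  shows "reachable (induce G S') u v"
proof -
  have "{(x, y). {x, y} \<in> edges (induce G S)} \<subseteq> {(x, y). {x, y} \<in> edges (induce G S')}"
    using assms(2) by (auto simp: induce_def)
  then show ?thesis using assms(1) rtrancl_mono unfolding reachable_def by blast
qed

text \<open>All branch sets that have to be constructed by hand below consist of a centre and some of its
  neighbours.\<close>

lemma connected_induce_star:
  assumes "a \<in> S" and "\<And>b. b \<in> S \<Longrightarrow> b \<noteq> a \<Longrightarrow> {a, b} \<in> edges G"
  shows "connected_graph (induce G S)"
proof -
  have "reachable (induce G S) a b" if "b \<in> S" for b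
    using that assms by (cases "b = a") (auto intro: reachable_refl reachable_edge simp: induce_def)
  then show ?thesis
    using assms(1) unfolding connected_graph_def
    by (metis empty_iff induce_def reachable_sym reachable_trans select_convs(1))
qed

text \<open>Replacing every vertex of a branch set in \<open>F\<close> by its own branch set in \<open>G\<close> gives a branch set in
  \<open>G\<close>; a walk in \<open>F\<close> lifts to \<open>G\<close> because consecutive inner branch sets are connected and joined by an
  edge. Every later minor is built by one simple step (a contraction, a subgraph, a contracted
  witness) composed through this lemma.\<close>

lemma minor_trans:
  assumes "is_minor M F" "is_minor F G"
  shows "is_minor M G"
proof -
  obtain B where B: "\<And>x. x \<in> verts M \<Longrightarrow> B x \<subseteq> verts F \<and> connected_graph (induce F (B x))"
    "\<And>x y. x \<in> verts M \<Longrightarrow> y \<in> verts M \<Longrightarrow> x \<noteq> y \<Longrightarrow> B x \<inter> B y = {}"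
    "\<And>x y. {x, y} \<in> edges M \<Longrightarrow> \<exists>u\<in>B x. \<exists>v\<in>B y. {u, v} \<in> edges F"
    using assms(1) unfolding is_minor_def by metis
  obtain C where C: "\<And>x. x \<in> verts F \<Longrightarrow> C x \<subseteq> verts G \<and> connected_graph (induce G (C x))"
    "\<And>x y. x \<in> verts F \<Longrightarrow> y \<in> verts F \<Longrightarrow> x \<noteq> y \<Longrightarrow> C x \<inter> C y = {}"
    "\<And>x y. {x, y} \<in> edges F \<Longrightarrow> \<exists>u\<in>C x. \<exists>v\<in>C y. {u, v} \<in> edges G"
    using assms(2) unfolding is_minor_def by metis
  define D where "D x = (\<Union>a\<in>B x. C a)" for x
  have conn: "connected_graph (induce G (D x))" if x: "x \<in> verts M" for x
  proof -
    have inner: "reachable (induce G (D x)) u v" if "a \<in> B x" "u \<in> C a" "v \<in> C a" for a u v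
    proof (rule reachable_induce_mono)
      show "reachable (induce G (C a)) u v"
        using C(1) B(1)[OF x] that by (auto simp: connected_graph_def induce_def)
    qed (use that in \<open>auto simp: D_def\<close>)
    have walk: "reachable (induce G (D x)) u v"
      if r: "reachable (induce F (B x)) a b" and ab: "a \<in> B x" "u \<in> C a" "v \<in> C b" for a b u v
    proof -
      have "(a, b) \<in> {(y, z). {y, z} \<in> edges (induce F (B x))}\<^sup>*"
        using r by (simp add: reachable_def)
      then show ?thesis using ab(3)
      proof (induction arbitrary: v)
        case base
        then show ?case using inner ab by blast
      next
        case (step y z)
        then have yz: "{y, z} \<in> edges F" "y \<in> B x" "z \<in> B x" by (auto simp: induce_def)
        from C(3)[OF yz(1)] obtain p q where pq: "p \<in> C y" "q \<in> C z" "{p, q} \<in> edges G" by blast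
        have "reachable (induce G (D x)) p q"
          using pq yz by (intro reachable_edge) (auto simp: induce_def D_def)
        then show ?case
          using step.IH[OF pq(1)] inner[OF yz(3) pq(2) step.prems] by (metis reachable_trans)
      qed
    qed
    have "B x \<noteq> {}" using B(1)[OF x] by (auto simp: connected_graph_def induce_def)
    moreover have "C a \<noteq> {}" if "a \<in> B x" for a
      using C(1)[of a] B(1)[OF x] that by (auto simp: connected_graph_def induce_def)
    ultimately have "D x \<noteq> {}" by (auto simp: D_def)
    moreover have "reachable (induce F (B x)) a b" if "a \<in> B x" "b \<in> B x" for a b
      using B(1)[OF x] that by (auto simp: connected_graph_def induce_def)
    ultimately have "reachable (induce G (D x)) u v" if "u \<in> D x" "v \<in> D x" for u v
      using walk that unfolding D_def by blast
    then show ?thesis using \<open>D x \<noteq> {}\<close> by (simp add: connected_graph_def induce_def)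
  qed
  show ?thesis unfolding is_minor_def
  proof (intro exI[of _ D] conjI ballI allI impI)
    show "connected_graph (induce G (D x))" "D x \<subseteq> verts G" if "x \<in> verts M" for x
      using conn that B(1)[OF that] C(1) by (auto simp: D_def)
    show "D x \<inter> D y = {}" if "x \<in> verts M" "y \<in> verts M" "x \<noteq> y" for x y
    proof -
      have "C a \<inter> C b = {}" if "a \<in> B x" "b \<in> B y" for a b
        using B(1,2) C(2) that \<open>x \<in> verts M\<close> \<open>y \<in> verts M\<close> \<open>x \<noteq> y\<close> by blast
      then show ?thesis by (fastforce simp: D_def)
    qed
    show "\<exists>u\<in>D x. \<exists>v\<in>D y. {u, v} \<in> edges G" if "{x, y} \<in> edges M" for x y
      using B(3)[OF that] C(3) by (fastforce simp: D_def)
  qed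
qed

lemma subgraph_is_minor:
  assumes "subgraph K G"
  shows "is_minor K G"
  unfolding is_minor_def
  using assms by (intro exI[of _ "\<lambda>x. {x}"]) (auto simp: subgraph_def intro: connected_induce_star)

lemma simple_induce: "simple_graph G \<Longrightarrow> S \<subseteq> verts G \<Longrightarrow> simple_graph (induce G S)"
  by (auto simp: simple_graph_def induce_def finite_subset)

lemma subgraph_induce: "simple_graph G \<Longrightarrow> S \<subseteq> verts G \<Longrightarrow> subgraph (induce G S) G"
  using simple_induce by (auto simp: subgraph_def induce_def)

lemma simple_edgeD:
  assumes "simple_graph G" "{u, v} \<in> edges G"
  shows "u \<in> verts G" "v \<in> verts G" "u \<noteq> v"
  using assms by (auto simp: simple_graph_def)

lemma simple_no_loop: "simple_graph G \<Longrightarrow> {v} \<notin> edges G"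
  by (auto simp: simple_graph_def)

lemma simple_edgeE:
  assumes "simple_graph G" "e \<in> edges G"
  obtains u v where "e = {u, v}" "u \<noteq> v" "u \<in> verts G" "v \<in> verts G"
  using assms by (fastforce simp: simple_graph_def card_2_iff)

definition complete_graph :: "nat \<Rightarrow> nat ugraph" where
  "complete_graph n = \<lparr>verts = {..<n}, edges = {{i, j} | i j. i < n \<and> j < n \<and> i \<noteq> j}\<rparr>"

lemma minor_of_complete_graph:
  assumes "simple_graph M"
  shows "is_minor M (complete_graph (card (verts M)))"
proof -
  obtain h where h: "bij_betw h (verts M) {..<card (verts M)}"
    using ex_bij_betw_finite_nat[of "verts M"] assms
    by (auto simp: simple_graph_def atLeast0LessThan)
  have ne: "h x \<noteq> h y" if "x \<in> verts M" "y \<in> verts M" "x \<noteq> y" for x y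
    using h that by (auto simp: bij_betw_def inj_on_def)
  have lt: "h x < card (verts M)" if "x \<in> verts M" for x
    using h that by (auto simp: bij_betw_def)
  show ?thesis unfolding is_minor_def
  proof (intro exI[of _ "\<lambda>x. {h x}"] conjI ballI allI impI)
    show "\<exists>u\<in>{h x}. \<exists>v\<in>{h y}. {u, v} \<in> edges (complete_graph (card (verts M)))"
      if "{x, y} \<in> edges M" for x y
    proof -
      note xy = simple_edgeD[OF assms that]
      have "{h x, h y} \<in> edges (complete_graph (card (verts M)))"
        using lt xy(1,2) ne[OF xy] unfolding complete_graph_def by fastforce
      then show ?thesis by simp
    qed
  qed (use ne lt in \<open>auto simp: complete_graph_def intro: connected_induce_star\<close>)
qed

section \<open>Dense graphs have large clique minors\<close>

text \<open>Each edge counts twice in \<open>arcs\<close>, so that the number of arcs is the sum of the degrees and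
  the handshake lemma needs no division.\<close>

definition arcs :: "'a ugraph \<Rightarrow> ('a \<times> 'a) set" where
  "arcs G = {(u, v). {u, v} \<in> edges G}"

definition neighbours :: "'a ugraph \<Rightarrow> 'a \<Rightarrow> 'a set" where
  "neighbours G v = {w. {v, w} \<in> edges G}"

text \<open>The edge \<open>{u, v}\<close> is contracted onto \<open>u\<close>.\<close>

definition contract :: "'a ugraph \<Rightarrow> 'a \<Rightarrow> 'a \<Rightarrow> 'a ugraph" where
  "contract G u v = \<lparr>verts = verts G - {v},
     edges = {e \<in> edges G. v \<notin> e} \<union> {{u, w} | w. w \<noteq> u \<and> {v, w} \<in> edges G}\<rparr>"

lemma finite_arcs: "simple_graph G \<Longrightarrow> finite (arcs G)"
  by (rule finite_subset[of _ "verts G \<times> verts G"])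
    (auto simp: arcs_def simple_graph_def)

lemma neighbours_subset: "simple_graph G \<Longrightarrow> neighbours G v \<subseteq> verts G"
  by (auto simp: neighbours_def simple_graph_def)

lemma finite_neighbours: "simple_graph G \<Longrightarrow> finite (neighbours G v)"
  using neighbours_subset by (metis finite_subset simple_graph_def)

lemma contract_is_minor:
  assumes "simple_graph G" "{u, v} \<in> edges G"
  shows "is_minor (contract G u v) G"
proof -
  note uv = simple_edgeD[OF assms]
  define B where "B x = (if x = u then {u, v} else {x})" for x
  have vu: "{v, u} \<in> edges G" using assms(2) by (simp add: insert_commute)
  show ?thesis unfolding is_minor_def
  proof (intro exI[of _ B] conjI ballI allI impI)
    fix x assume x: "x \<in> verts (contract G u v)"
    show "B x \<subseteq> verts G" using x uv by (auto simp: B_def contract_def)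
    show "connected_graph (induce G (B x))"
      using assms(2) by (intro connected_induce_star[of x]) (auto simp: B_def split: if_splits)
  next
    fix x y assume "x \<in> verts (contract G u v)" "y \<in> verts (contract G u v)" "x \<noteq> y"
    then show "B x \<inter> B y = {}" using uv by (auto simp: B_def contract_def)
  next
    fix x y assume xy: "{x, y} \<in> edges (contract G u v)"
    show "\<exists>a\<in>B x. \<exists>b\<in>B y. {a, b} \<in> edges G"
    proof (cases "{x, y} \<in> edges G")
      case True
      then show ?thesis by (intro bexI[of _ x] bexI[of _ y]) (auto simp: B_def)
    next
      case False
      then obtain w where w: "{x, y} = {u, w}" "{v, w} \<in> edges G"
        using xy by (auto simp: contract_def)
      then consider "x = u" "y = w" | "x = w" "y = u" by (auto simp: doubleton_eq_iff)
      then show ?thesis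
      proof cases
        case 1
        then show ?thesis using w(2) by (intro bexI[of _ v] bexI[of _ w]) (auto simp: B_def)
      next
        case 2
        then show ?thesis using w(2)
          by (intro bexI[of _ w] bexI[of _ v]) (auto simp: B_def insert_commute)
      qed
    qed
  qed
qed

lemma contract_simple:
  assumes "simple_graph G" "{u, v} \<in> edges G"
  shows "simple_graph (contract G u v)"
proof -
  have "e \<subseteq> verts G - {v} \<and> card e = 2" if e': "e \<in> edges (contract G u v)" for e
  proof (cases "e \<in> edges G \<and> v \<notin> e")
    case True
    then show ?thesis using assms(1) by (auto simp: simple_graph_def)
  next
    case False
    then obtain w where w: "e = {u, w}" "w \<noteq> u" "{v, w} \<in> edges G"
      using e' by (auto simp: contract_def)
    then show ?thesis using simple_edgeD[OF assms] simple_edgeD[OF assms(1) w(3)] by simp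
  qed
  then show ?thesis using assms(1) by (simp add: simple_graph_def contract_def)
qed

text \<open>Contracting \<open>{u, v}\<close> destroys that edge and merges, for every common neighbour \<open>w\<close>, the edges
  from \<open>w\<close> to \<open>u\<close> and to \<open>v\<close>. Hence a contraction that lowers the density must have had many
  common neighbours.\<close>

lemma card_arcs_contract:
  assumes G: "simple_graph G" and e: "{u, v} \<in> edges G"
  shows "card (arcs G) = card (arcs (contract G u v)) + 2 + 2 * card (neighbours G u \<inter> neighbours G v)"
proof -
  \<comment> \<open>\<open>A0\<close> is untouched by the contraction, and \<open>X\<close> is what \<open>u\<close> inherits from \<open>v\<close>.\<close>
  define A0 where "A0 = {(x, y) \<in> arcs G. x \<noteq> v \<and> y \<noteq> v}"
  define X where "X = neighbours G v - {u} - neighbours G u"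
  note uv = simple_edgeD[OF G e]
  note sE = simple_edgeD[OF G]
  have fA: "finite A0" using finite_arcs[OF G] unfolding A0_def by (auto intro: finite_subset[rotated])
  have fN: "finite (neighbours G v)" and fX: "finite X"
    using finite_neighbours[OF G] by (auto simp: X_def)
  have a1: "arcs G = A0 \<union> (Pair v ` neighbours G v \<union> (\<lambda>w. (w, v)) ` neighbours G v)"
    by (auto simp: A0_def arcs_def neighbours_def insert_commute)
  have d1: "A0 \<inter> (Pair v ` neighbours G v \<union> (\<lambda>w. (w, v)) ` neighbours G v) = {}"
    "Pair v ` neighbours G v \<inter> (\<lambda>w. (w, v)) ` neighbours G v = {}"
    using simple_no_loop[OF G] by (auto simp: A0_def neighbours_def)
  have c1: "card (arcs G) = card A0 + 2 * card (neighbours G v)"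
    unfolding a1 using fA fN d1
    by (simp add: card_Un_disjoint card_image inj_on_def)
  have a2: "arcs (contract G u v) = A0 \<union> (Pair u ` X \<union> (\<lambda>w. (w, u)) ` X)"
  proof (intro set_eqI, clarify)
    fix x y
    have "(x, y) \<in> arcs (contract G u v) \<longleftrightarrow> (x, y) \<in> A0 \<or>
        (x = u \<and> y \<noteq> u \<and> {v, y} \<in> edges G) \<or> (y = u \<and> x \<noteq> u \<and> {v, x} \<in> edges G)"
      unfolding A0_def arcs_def contract_def by (simp add: doubleton_eq_iff) blast
    moreover have "y \<noteq> v" if "{v, y} \<in> edges G" for y using sE(3)[OF that] by simp
    ultimately show "(x, y) \<in> arcs (contract G u v) \<longleftrightarrow>
        (x, y) \<in> A0 \<union> (Pair u ` X \<union> (\<lambda>w. (w, u)) ` X)"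
      using uv(3) sE(3) by (auto simp: A0_def arcs_def X_def neighbours_def insert_commute)
  qed
  have d2: "A0 \<inter> (Pair u ` X \<union> (\<lambda>w. (w, u)) ` X) = {}"
    "Pair u ` X \<inter> (\<lambda>w. (w, u)) ` X = {}"
    by (auto simp: A0_def X_def neighbours_def arcs_def insert_commute)
  have c2: "card (arcs (contract G u v)) = card A0 + 2 * card X"
    unfolding a2 using fA fX d2
    by (simp add: card_Un_disjoint card_image inj_on_def)
  have "neighbours G v = insert u (X \<union> (neighbours G u \<inter> neighbours G v))"
    using e by (auto simp: X_def neighbours_def insert_commute)
  moreover have "u \<notin> X \<union> (neighbours G u \<inter> neighbours G v)"
    using simple_no_loop[OF G] by (auto simp: X_def neighbours_def)
  moreover have "X \<inter> (neighbours G u \<inter> neighbours G v) = {}" by (auto simp: X_def)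
  ultimately have "card (neighbours G v) = Suc (card X + card (neighbours G u \<inter> neighbours G v))"
    using fX fN by (metis card_Un_disjoint card_insert_disjoint finite_Int finite_UnI)
  then show ?thesis using c1 c2 by simp
qed

text \<open>The vertex \<open>u\<close> becomes the last branch set: it is adjacent to every branch set inside its
  neighbourhood.\<close>

lemma clique_minor_extend:
  assumes G: "simple_graph G"
    and m: "is_minor (complete_graph t) (induce G (neighbours G u))" and u: "u \<in> verts G"
  shows "is_minor (complete_graph (Suc t)) G"
proof -
  let ?N = "induce G (neighbours G u)"
  have V: "verts (complete_graph t) = {..<t}" "verts ?N = neighbours G u"
    by (simp_all add: complete_graph_def induce_def)
  obtain B where B: "\<And>x. x < t \<Longrightarrow> B x \<subseteq> neighbours G u \<and> connected_graph (induce ?N (B x))"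
    "\<And>x y. x < t \<Longrightarrow> y < t \<Longrightarrow> x \<noteq> y \<Longrightarrow> B x \<inter> B y = {}"
    "\<And>x y. {x, y} \<in> edges (complete_graph t) \<Longrightarrow> \<exists>u\<in>B x. \<exists>v\<in>B y. {u, v} \<in> edges ?N"
    using m unfolding is_minor_def V Ball_def lessThan_iff by metis
  have ii: "induce ?N (B x) = induce G (B x)" if "x < t" for x
    using B(1)[OF that] by (auto simp: induce_def)
  have ne: "B x \<noteq> {}" if "x < t" for x
    using B(1)[OF that] by (auto simp: connected_graph_def induce_def)
  have un: "u \<notin> neighbours G u" using simple_no_loop[OF G] by (auto simp: neighbours_def)
  define C where "C x = (if x = t then {u} else B x)" for x
  have apex: "\<exists>w\<in>B x. {u, w} \<in> edges G" if "x < t" for x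
    using B(1)[OF that] ne[OF that] by (auto simp: neighbours_def)
  show ?thesis unfolding is_minor_def
  proof (intro exI[of _ C] conjI ballI allI impI)
    fix x assume x: "x \<in> verts (complete_graph (Suc t))"
    have "B x \<subseteq> verts G" if "x < t"
      using B(1)[OF that] neighbours_subset[OF G, of u] by blast
    then show "C x \<subseteq> verts G" using x u by (auto simp: C_def complete_graph_def)
    show "connected_graph (induce G (C x))"
      using x B(1)[of x] ii[of x]
      by (auto simp: C_def complete_graph_def intro: connected_induce_star)
  next
    fix x y assume "x \<in> verts (complete_graph (Suc t))" "y \<in> verts (complete_graph (Suc t))" "x \<noteq> y"
    then show "C x \<inter> C y = {}"
      using B(1)[of x] B(1)[of y] B(2)[of x y] un by (auto simp: C_def complete_graph_def)
  next
    fix x y assume xy: "{x, y} \<in> edges (complete_graph (Suc t))"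
    then have "x \<noteq> y" "x < Suc t" "y < Suc t" by (auto simp: complete_graph_def doubleton_eq_iff)
    then consider "x = t" "y < t" | "y = t" "x < t" | "x < t" "y < t" "x \<noteq> y" by linarith
    then show "\<exists>a\<in>C x. \<exists>b\<in>C y. {a, b} \<in> edges G"
    proof cases
      case 3
      then have "{x, y} \<in> edges (complete_graph t)" by (auto simp: complete_graph_def)
      from B(3)[OF this] show ?thesis using 3 by (auto simp: C_def induce_def)
    qed (use apex in \<open>auto simp: C_def insert_commute\<close>)
  qed
qed

lemma min_degree_arcs:
  assumes "simple_graph G" "\<And>v. v \<in> verts G \<Longrightarrow> d \<le> card (neighbours G v)"
  shows "d * card (verts G) \<le> card (arcs G)"
proof -
  have "arcs G = (SIGMA v:verts G. neighbours G v)"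
    using simple_edgeD[OF assms(1)] by (auto simp: arcs_def neighbours_def)
  then have "card (arcs G) = (\<Sum>v\<in>verts G. card (neighbours G v))"
    using assms(1) finite_neighbours[OF assms(1)] by (simp add: simple_graph_def)
  then show ?thesis using sum_mono[of "verts G" "\<lambda>_. d", OF assms(2)] by (simp add: mult.commute)
qed

text \<open>Mader's theorem, with a constant that makes the induction short. If some edge has few common
  neighbours, contracting it keeps the density, and the number of vertices drops. If no edge has
  few, then every neighbourhood induces a graph of minimum degree at least \<open>2 ^ t\<close>; the induction
  on \<open>t\<close> finds a clique minor there, and the common neighbour extends it.\<close>

theorem dense_graph_clique_minor:
  assumes "simple_graph G" "verts G \<noteq> {}" "2 ^ t * card (verts G) \<le> card (arcs G)"
  shows "is_minor (complete_graph t) G"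
  using assms
proof (induction t arbitrary: G)
  case 0
  then show ?case by (simp add: is_minor_def complete_graph_def)
next
  case (Suc t)
  show ?case using Suc.prems
  proof (induction "card (verts G)" arbitrary: G rule: less_induct)
    case less
    note G = less.prems(1)
    have fV: "finite (verts G)" using G by (simp add: simple_graph_def)
    have "card (verts G) > 0" using fV less.prems(2) by (simp add: card_gt_0_iff)
    then have "card (arcs G) > 0" using less.prems(3) by (metis le_zero_eq mult_is_0 not_gr_zero power_not_zero zero_neq_numeral)
    then obtain u0 v0 where e0: "{u0, v0} \<in> edges G" by (auto simp: card_gt_0_iff arcs_def)
    show ?case
    proof (cases "\<exists>u v. {u, v} \<in> edges G \<and> card (neighbours G u \<inter> neighbours G v) < 2 ^ t")
      case True
      then obtain u v where e: "{u, v} \<in> edges G"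
        and few: "card (neighbours G u \<inter> neighbours G v) < 2 ^ t" by blast
      note uv = simple_edgeD[OF G e]
      have V': "verts (contract G u v) = verts G - {v}" by (simp add: contract_def)
      have cV: "card (verts G) = Suc (card (verts (contract G u v)))"
        using uv fV by (metis V' card.remove)
      have "2 ^ Suc t * card (verts (contract G u v)) \<le> card (arcs (contract G u v))"
        using less.prems(3) few card_arcs_contract[OF G e] unfolding cV by simp
      moreover have "card (verts (contract G u v)) < card (verts G)" "verts (contract G u v) \<noteq> {}"
        using cV uv V' by auto
      ultimately have "is_minor (complete_graph (Suc t)) (contract G u v)"
        using less.hyps[OF _ contract_simple[OF G e]] by blast
      then show ?thesis using contract_is_minor[OF G e] minor_trans by blast
    next
      case False
      let ?N = "induce G (neighbours G u0)"
      have N: "simple_graph ?N" using simple_induce[OF G neighbours_subset[OF G]] .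
      have "2 ^ t \<le> card (neighbours ?N v)" if v: "v \<in> verts ?N" for v
      proof -
        have "neighbours ?N v = neighbours G u0 \<inter> neighbours G v"
          using v by (auto simp: neighbours_def induce_def)
        then show ?thesis using False v by (auto simp: induce_def neighbours_def not_less)
      qed
      then have "2 ^ t * card (verts ?N) \<le> card (arcs ?N)" by (intro min_degree_arcs N)
      moreover have "verts ?N \<noteq> {}" using e0 by (auto simp: induce_def neighbours_def)
      ultimately have "is_minor (complete_graph t) ?N" using Suc.IH N by blast
      then show ?thesis using clique_minor_extend[OF G] simple_edgeD[OF G e0] by blast
    qed
  qed
qed

text \<open>The bound holds for all minors \<open>F\<close> of \<open>H\<close>, not just for subgraphs. This is what separates
  minor-closed classes from classes of bounded maximum average degree, and it is used below for a
  minor that is not a subgraph.\<close>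

lemma minor_free_arcs:
  assumes "simple_graph M" "minor_free M H" "simple_graph F" "is_minor F H"
  shows "card (arcs F) \<le> 2 ^ card (verts M) * card (verts F)"
proof (cases "verts F = {}")
  case True
  then have "arcs F = {}" using simple_edgeD[OF assms(3)] by (auto simp: arcs_def)
  then show ?thesis by simp
next
  case False
  then show ?thesis
    using dense_graph_clique_minor[OF assms(3) False] minor_of_complete_graph[OF assms(1)]
      minor_trans assms(2,4) unfolding minor_free_def by (meson nle_le)
qed

section \<open>Sparse relations and star colourings\<close>

text \<open>Over ordered pairs, sparseness bounds the average degree of every induced subgraph. It is
  additive over unions of relations and implies degeneracy, hence bounded chromatic number; so
  finitely many sparse conflict relations can be respected by one bounded colouring.\<close>

definition sparse :: "nat \<Rightarrow> 'a set \<Rightarrow> ('a \<Rightarrow> 'a \<Rightarrow> bool) \<Rightarrow> bool" where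
  "sparse d V R \<longleftrightarrow> (\<forall>A\<subseteq>V. card {(u, v) \<in> A \<times> A. R u v} \<le> d * card A)"

lemma sparse_subset: "sparse d V R \<Longrightarrow> W \<subseteq> V \<Longrightarrow> sparse d W R"
  by (auto simp: sparse_def)

lemma sparse_union:
  assumes "finite V" "sparse d V R" "sparse e V Q"
  shows "sparse (d + e) V (\<lambda>u v. R u v \<or> Q u v)"
  unfolding sparse_def
proof (intro allI impI)
  fix A assume A: "A \<subseteq> V"
  have "{(u, v) \<in> A \<times> A. R u v \<or> Q u v} = {(u, v) \<in> A \<times> A. R u v} \<union> {(u, v) \<in> A \<times> A. Q u v}"
    by auto
  then have "card {(u, v) \<in> A \<times> A. R u v \<or> Q u v}
      \<le> card {(u, v) \<in> A \<times> A. R u v} + card {(u, v) \<in> A \<times> A. Q u v}"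
    by (simp add: card_Un_le)
  also have "\<dots> \<le> d * card A + e * card A"
    using assms(2,3) A unfolding sparse_def by (intro add_mono) auto
  finally show "card {(u, v) \<in> A \<times> A. R u v \<or> Q u v} \<le> (d + e) * card A"
    by (simp add: algebra_simps)
qed

lemma sparse_bounded_outdegree:
  assumes V: "finite V" and T: "\<And>x. x \<in> V \<Longrightarrow> card {z \<in> V. T x z} \<le> k"
  shows "sparse (2 * k) V (\<lambda>x z. T x z \<or> T z x)"
proof -
  have one: "card {(x, z) \<in> A \<times> A. T x z} \<le> k * card A" if A: "A \<subseteq> V" for A
  proof -
    have fA: "finite A" using A V finite_subset by blast
    have "{(x, z) \<in> A \<times> A. T x z} = (SIGMA x:A. {z \<in> A. T x z})" by auto
    then have "card {(x, z) \<in> A \<times> A. T x z} = (\<Sum>x\<in>A. card {z \<in> A. T x z})"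
      using fA by simp
    also have "\<dots> \<le> (\<Sum>x\<in>A. k)"
    proof (rule sum_mono)
      fix x assume "x \<in> A"
      then have "card {z \<in> A. T x z} \<le> card {z \<in> V. T x z}" using A V by (intro card_mono) auto
      then show "card {z \<in> A. T x z} \<le> k" using T[of x] A \<open>x \<in> A\<close> by auto
    qed
    finally show ?thesis by (simp add: mult.commute)
  qed
  have two: "card {(x, z) \<in> A \<times> A. T z x} \<le> k * card A" if A: "A \<subseteq> V" for A
  proof -
    have "{(x, z) \<in> A \<times> A. T z x} = prod.swap ` {(x, z) \<in> A \<times> A. T x z}" by force
    then show ?thesis using one[OF A] by (simp add: card_image)
  qed
  have "sparse (k + k) V (\<lambda>x z. T x z \<or> T z x)"
    using one two V by (intro sparse_union) (auto simp: sparse_def)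
  then show ?thesis by (simp add: mult_2)
qed

lemma sparse_low_degree:
  assumes "finite V" "V \<noteq> {}" "sparse d V R"
  shows "\<exists>v\<in>V. card {u \<in> V. R v u} \<le> d"
proof (rule ccontr)
  assume "\<not> ?thesis"
  then have "(\<Sum>v\<in>V. d) < (\<Sum>v\<in>V. card {u \<in> V. R v u})"
    using assms by (intro sum_strict_mono) auto
  also have "\<dots> = card (SIGMA v:V. {u \<in> V. R v u})" using assms(1) by simp
  also have "(SIGMA v:V. {u \<in> V. R v u}) = {(u, v) \<in> V \<times> V. R u v}" by auto
  finally show False using assms(3) by (auto simp: sparse_def mult.commute not_less[symmetric])
qed

text \<open>A vertex of low degree is removed and ranked last. The bound \<open>r v < card V\<close> strengthens the
  induction hypothesis so that the removed vertex can receive the next rank.\<close>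

lemma sparse_ranking:
  assumes "finite V" "sparse d V R"
  shows "\<exists>r :: 'a \<Rightarrow> nat. inj_on r V \<and> (\<forall>v\<in>V. r v < card V) \<and>
    (\<forall>v\<in>V. card {u \<in> V. R v u \<and> r u < r v} \<le> d)"
  using assms
proof (induction "card V" arbitrary: V)
  case 0
  then show ?case by simp
next
  case (Suc n)
  then have "V \<noteq> {}" by auto
  then obtain v where v: "v \<in> V" "card {u \<in> V. R v u} \<le> d"
    using sparse_low_degree Suc.prems by metis
  let ?W = "V - {v}"
  have n: "card ?W = n" using Suc.hyps(2) v(1) Suc.prems(1) by simp
  obtain r :: "'a \<Rightarrow> nat" where r: "inj_on r ?W" "\<And>u. u \<in> ?W \<Longrightarrow> r u < n"
    "\<And>w. w \<in> ?W \<Longrightarrow> card {u \<in> ?W. R w u \<and> r u < r w} \<le> d"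
    using Suc.hyps(1)[of ?W] n Suc.prems sparse_subset[of d V R ?W] by auto
  define s where "s = r(v := n)"
  have "card {u \<in> V. R w u \<and> s u < s w} \<le> d" if w: "w \<in> V" for w
  proof (cases "w = v")
    case True
    have "card {u \<in> V. R w u \<and> s u < s w} \<le> card {u \<in> V. R v u}"
      using Suc.prems True by (intro card_mono) auto
    then show ?thesis using v(2) by simp
  next
    case False
    then have "{u \<in> V. R w u \<and> s u < s w} = {u \<in> ?W. R w u \<and> r u < r w}"
      using r(2)[of w] w by (auto simp: s_def)
    then show ?thesis using r(3)[of w] False w by simp
  qed
  moreover have "inj_on s V"
  proof -
    have "inj_on s ?W" using r(1) by (simp add: s_def inj_on_def)
    moreover have "s v \<notin> s ` ?W"
    proof
      assume "s v \<in> s ` ?W"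
      then obtain u where "u \<in> ?W" "r u = n" by (auto simp: s_def)
      then show False using r(2)[of u] by simp
    qed
    ultimately have "inj_on s (insert v ?W)" unfolding inj_on_insert by simp
    then show ?thesis using v(1) by (metis insert_Diff)
  qed
  moreover have "\<forall>u\<in>V. s u < card V"
    using r(2) Suc.hyps(2)[symmetric] by (auto simp: s_def less_Suc_eq)
  ultimately show ?case by blast
qed

lemma sparse_colouring:
  assumes "finite V" "sparse d V R" "\<And>u v. R u v \<Longrightarrow> R v u" "\<And>u. \<not> R u u"
  shows "\<exists>c :: 'a \<Rightarrow> nat. (\<forall>v. c v \<le> d) \<and> (\<forall>u\<in>V. \<forall>v\<in>V. R u v \<longrightarrow> c u \<noteq> c v)"
  using assms(1,2)
proof (induction "card V" arbitrary: V)
  case 0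
  then show ?case by (intro exI[of _ "\<lambda>_. 0"]) auto
next
  case (Suc n)
  then have "V \<noteq> {}" by auto
  then obtain v where v: "v \<in> V" "card {u \<in> V. R v u} \<le> d"
    using sparse_low_degree Suc.prems by metis
  let ?W = "V - {v}"
  have n: "card ?W = n" using Suc.hyps(2) v(1) Suc.prems(1) by simp
  obtain c :: "'a \<Rightarrow> nat" where c: "\<And>v. c v \<le> d"
    "\<And>a b. a \<in> ?W \<Longrightarrow> b \<in> ?W \<Longrightarrow> R a b \<Longrightarrow> c a \<noteq> c b"
    using Suc.hyps(1)[of ?W] n Suc.prems sparse_subset[of d V R ?W] by auto
  have "card (c ` {u \<in> V. R v u}) \<le> d"
    using card_image_le[of "{u \<in> V. R v u}" c] v(2) Suc.prems(1) by simp
  then have "\<not> {..d} \<subseteq> c ` {u \<in> V. R v u}"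
    using card_mono[of "c ` {u \<in> V. R v u}" "{..d}"] Suc.prems(1) by auto
  then obtain k where k: "k \<le> d" "k \<notin> c ` {u \<in> V. R v u}" by auto
  have "\<forall>a\<in>V. \<forall>b\<in>V. R a b \<longrightarrow> (c(v := k)) a \<noteq> (c(v := k)) b"
  proof (intro ballI impI)
    fix a b assume ab: "a \<in> V" "b \<in> V" "R a b"
    have kv: "c u \<noteq> k" if "u \<in> V" "R v u" for u using k(2) that by auto
    show "(c(v := k)) a \<noteq> (c(v := k)) b"
      using ab assms(3)[OF ab(3)] assms(4) kv[of a] kv[of b] c(2)[of a b] by auto
  qed
  moreover have "\<forall>u. (c(v := k)) u \<le> d" using c(1) k(1) by simp
  ultimately show ?case by blast
qed

text \<open>The second condition forbids paths on four vertices that use only two colours. Properness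
  already excludes \<open>a = y\<close>, so any two colour classes induce a forest of stars.\<close>

definition star_colouring :: "'a ugraph \<Rightarrow> ('a \<Rightarrow> nat) \<Rightarrow> bool" where
  "star_colouring H c \<longleftrightarrow> (\<forall>u v. {u, v} \<in> edges H \<longrightarrow> c u \<noteq> c v) \<and>
     (\<forall>a b x y. {a, b} \<in> edges H \<and> {b, x} \<in> edges H \<and> {x, y} \<in> edges H \<and> a \<noteq> x \<and> b \<noteq> y \<longrightarrow>
        c a \<noteq> c x \<or> c b \<noteq> c y)"

lemma minor_free_sparse:
  assumes "simple_graph M" "minor_free M H" "simple_graph H"
  shows "sparse (2 ^ card (verts M)) (verts H) (\<lambda>u v. {u, v} \<in> edges H)"
  unfolding sparse_def
proof (intro allI impI)
  fix A assume A: "A \<subseteq> verts H"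
  have "arcs (induce H A) = {(u, v) \<in> A \<times> A. {u, v} \<in> edges H}"
    by (auto simp: arcs_def induce_def)
  moreover have "verts (induce H A) = A" by (simp add: induce_def)
  ultimately show "card {(u, v) \<in> A \<times> A. {u, v} \<in> edges H} \<le> 2 ^ card (verts M) * card A"
    using minor_free_arcs[OF assms(1,2) simple_induce subgraph_is_minor] subgraph_induce
      assms(3) A by metis
qed

text \<open>When edges point to the endpoint of smaller rank, fraternal vertices are the pairs of
  out-neighbours of a common vertex.\<close>

definition fraternal :: "'a ugraph \<Rightarrow> ('a \<Rightarrow> nat) \<Rightarrow> 'a \<Rightarrow> 'a \<Rightarrow> bool" where
  "fraternal H r a c \<longleftrightarrow> a \<noteq> c \<and>
     (\<exists>b. {b, a} \<in> edges H \<and> {b, c} \<in> edges H \<and> r a < r b \<and> r c < r b)"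

text \<open>Contract each witness \<open>b\<close> into the vertex \<open>fst (p b)\<close>: this turns the pair \<open>p b\<close> into an edge of a
  minor of \<open>H\<close> whose vertex set is \<open>A\<close>. The witnesses must avoid \<open>A\<close> for the branch sets to be disjoint,
  and then the sparseness of minors bounds their number.\<close>

lemma fraternal_colour_class_bound:
  fixes H :: "'a ugraph" and p :: "'a \<Rightarrow> 'a \<times> 'a"
  assumes M: "simple_graph M" "minor_free M H" and H: "simple_graph H"
    and A: "A \<subseteq> verts H" and W: "W \<subseteq> verts H" "A \<inter> W = {}"
    and p: "inj_on p W" "\<And>b. b \<in> W \<Longrightarrow> fst (p b) \<in> A \<and> snd (p b) \<in> A \<and> fst (p b) \<noteq> snd (p b) \<and>
        {b, fst (p b)} \<in> edges H \<and> {b, snd (p b)} \<in> edges H"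
  shows "card W \<le> 2 ^ card (verts M) * card A"
proof -
  define F where "F = \<lparr>verts = A, edges = (\<lambda>b. {fst (p b), snd (p b)}) ` W\<rparr>"
  have fA: "finite A" using A H finite_subset by (auto simp: simple_graph_def)
  have sF: "simple_graph F" using fA p(2) by (auto simp: simple_graph_def F_def)
  define B where "B a = insert a {b \<in> W. fst (p b) = a}" for a
  have "is_minor F H" unfolding is_minor_def
  proof (intro exI[of _ B] conjI ballI allI impI)
    fix x assume x: "x \<in> verts F"
    show "B x \<subseteq> verts H" using x A W by (auto simp: B_def F_def)
    show "connected_graph (induce H (B x))"
      using p(2) by (intro connected_induce_star[of x]) (auto simp: B_def insert_commute)
  next
    fix x y assume "x \<in> verts F" "y \<in> verts F" "x \<noteq> y"
    then show "B x \<inter> B y = {}" using W(2) by (auto simp: B_def F_def)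
  next
    fix x y assume "{x, y} \<in> edges F"
    then obtain b where b: "b \<in> W" "{x, y} = {fst (p b), snd (p b)}" by (auto simp: F_def)
    then consider "x = fst (p b)" "y = snd (p b)" | "y = fst (p b)" "x = snd (p b)"
      by (auto simp: doubleton_eq_iff)
    then show "\<exists>u\<in>B x. \<exists>v\<in>B y. {u, v} \<in> edges H"
    proof cases
      case 1
      then show ?thesis using b(1) p(2)[OF b(1)]
        by (intro bexI[of _ b] bexI[of _ y]) (auto simp: B_def)
    next
      case 2
      then show ?thesis using b(1) p(2)[OF b(1)]
        by (intro bexI[of _ x] bexI[of _ b]) (auto simp: B_def insert_commute)
    qed
  qed
  then have "card (arcs F) \<le> 2 ^ card (verts M) * card A"
    using minor_free_arcs[OF M sF] by (simp add: F_def)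
  moreover have "card W \<le> card (arcs F)"
  proof (rule card_inj_on_le[OF p(1) _ finite_arcs[OF sF]])
    have "{fst (p b), snd (p b)} \<in> edges F" if "b \<in> W" for b using that by (simp add: F_def)
    then show "p ` W \<subseteq> arcs F" unfolding arcs_def split_beta by blast
  qed
  ultimately show ?thesis by linarith
qed

text \<open>Two losses reduce this to the previous lemma. A witness has at most \<open>d\<close> out-neighbours, so
  it serves at most \<open>d\<^sup>2\<close> pairs, and it suffices to count witnesses. A witness may itself belong to
  \<open>A\<close>; but in a proper colouring it differs in colour from the vertices of its pair, so after
  fixing the colour \<open>j\<close> of the witness all pairs lie among the vertices of other colours.\<close>

lemma fraternal_sparse:
  fixes H :: "'a ugraph"
  assumes M: "simple_graph M" "minor_free M H" and H: "simple_graph H"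
    and d: "d = 2 ^ card (verts M)"
    and r: "\<And>v. v \<in> verts H \<Longrightarrow> card {u \<in> verts H. {v, u} \<in> edges H \<and> r u < r v} \<le> d"
  shows "sparse (Suc d * (d\<^sup>2 * d)) (verts H) (fraternal H r)"
  unfolding sparse_def
proof (intro allI impI)
  fix A assume A: "A \<subseteq> verts H"
  let ?V = "verts H"
  have fV: "finite ?V" using H by (simp add: simple_graph_def)
  have fA: "finite A" using fV A finite_subset by blast
  define P where "P = {(a, c) \<in> A \<times> A. fraternal H r a c}"
  have fP: "finite P" using fA by (auto simp: P_def intro: finite_subset[of _ "A \<times> A"])
  obtain col :: "'a \<Rightarrow> nat" where col: "\<And>v. col v \<le> d"
    "\<And>u v. u \<in> ?V \<Longrightarrow> v \<in> ?V \<Longrightarrow> {u, v} \<in> edges H \<Longrightarrow> col u \<noteq> col v"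
  proof -
    have "\<exists>c :: 'a \<Rightarrow> nat. (\<forall>v. c v \<le> d) \<and> (\<forall>u\<in>?V. \<forall>v\<in>?V. {u, v} \<in> edges H \<longrightarrow> c u \<noteq> c v)"
    proof (rule sparse_colouring[OF fV])
      show "sparse d ?V (\<lambda>u v. {u, v} \<in> edges H)" using minor_free_sparse[OF M H] d by simp
    qed (use simple_no_loop[OF H] in \<open>auto simp: insert_commute\<close>)
    then show thesis using that by blast
  qed
  define w where "w ac = (SOME b. {b, fst ac} \<in> edges H \<and> {b, snd ac} \<in> edges H \<and>
    r (fst ac) < r b \<and> r (snd ac) < r b)" for ac
  have w: "{w ac, fst ac} \<in> edges H" "{w ac, snd ac} \<in> edges H" "r (fst ac) < r (w ac)"
    "r (snd ac) < r (w ac)" if "ac \<in> P" for ac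
  proof -
    have "\<exists>b. {b, fst ac} \<in> edges H \<and> {b, snd ac} \<in> edges H \<and> r (fst ac) < r b \<and> r (snd ac) < r b"
      using that by (auto simp: P_def fraternal_def)
    from someI_ex[OF this]
    show "{w ac, fst ac} \<in> edges H" "{w ac, snd ac} \<in> edges H" "r (fst ac) < r (w ac)"
    "r (snd ac) < r (w ac)" unfolding w_def by auto
  qed
  have wV: "w ac \<in> ?V" if "ac \<in> P" for ac using simple_edgeD[OF H w(1)[OF that]] by simp
  define Q where "Q j = {ac \<in> P. col (w ac) = j}" for j
  have Q: "card (Q j) \<le> d\<^sup>2 * (d * card A)" for j
  proof -
    define W where "W = w ` Q j"
    have fW: "finite W" using fP by (simp add: W_def Q_def)
    have fibre: "card {ac \<in> Q j. w ac = b} \<le> d\<^sup>2" if "b \<in> W" for b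
    proof -
      let ?out = "{u \<in> ?V. {b, u} \<in> edges H \<and> r u < r b}"
      have "{ac \<in> Q j. w ac = b} \<subseteq> ?out \<times> ?out"
        using w A by (auto simp: Q_def P_def)
      then have "card {ac \<in> Q j. w ac = b} \<le> card (?out \<times> ?out)"
        using fV by (intro card_mono) auto
      also have "\<dots> = card ?out * card ?out" by (rule card_cartesian_product)
      also have "\<dots> \<le> d * d"
        using r[of b] that wV by (intro mult_mono) (auto simp: W_def Q_def)
      finally show ?thesis by (simp add: power2_eq_square)
    qed
    have "Q j = (\<Union>b\<in>W. {ac \<in> Q j. w ac = b})" by (auto simp: W_def)
    then have "card (Q j) \<le> (\<Sum>b\<in>W. card {ac \<in> Q j. w ac = b})"
      using card_UN_le[OF fW, of "\<lambda>b. {ac \<in> Q j. w ac = b}"] by simp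
    also have "\<dots> \<le> (\<Sum>b\<in>W. d\<^sup>2)" by (intro sum_mono fibre)
    finally have cQ: "card (Q j) \<le> d\<^sup>2 * card W" by (simp add: mult.commute)
    define p where "p = inv_into (Q j) w"
    have p: "p b \<in> Q j" "w (p b) = b" if "b \<in> W" for b
      using that by (auto simp: p_def W_def inv_into_into f_inv_into_f)
    let ?A = "{a \<in> A. col a \<noteq> j}"
    have "card W \<le> 2 ^ card (verts M) * card ?A"
    proof (rule fraternal_colour_class_bound[OF M H])
      show "?A \<subseteq> ?V" using A by auto
      show "W \<subseteq> ?V" using wV by (auto simp: W_def Q_def)
      show "?A \<inter> W = {}" by (auto simp: W_def Q_def)
      show "inj_on p W" using p by (metis inj_onI)
      show "fst (p b) \<in> ?A \<and> snd (p b) \<in> ?A \<and> fst (p b) \<noteq> snd (p b) \<and>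
        {b, fst (p b)} \<in> edges H \<and> {b, snd (p b)} \<in> edges H" if b: "b \<in> W" for b
      proof -
        have q: "p b \<in> P" "col b = j" using p[OF b] by (auto simp: Q_def)
        have e: "{b, fst (p b)} \<in> edges H" "{b, snd (p b)} \<in> edges H"
          using w[OF q(1)] p(2)[OF b] by auto
        have "col (fst (p b)) \<noteq> j" "col (snd (p b)) \<noteq> j"
          using col(2)[OF _ _ e(1)] col(2)[OF _ _ e(2)] q(2)
            simple_edgeD[OF H e(1)] simple_edgeD[OF H e(2)] by auto
        then show ?thesis using q(1) e by (auto simp: P_def fraternal_def)
      qed
    qed
    also have "\<dots> \<le> d * card A" using d fA by (intro mult_mono card_mono) auto
    finally show ?thesis using cQ by (meson le_trans mult_le_mono2)
  qed
  have "P = (\<Union>j\<in>{..d}. Q j)" using col(1) by (auto simp: Q_def)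
  then have "card P \<le> (\<Sum>j\<le>d. card (Q j))" using card_UN_le[of "{..d}" Q] by simp
  also have "\<dots> \<le> (\<Sum>j\<le>d. d\<^sup>2 * (d * card A))" by (intro sum_mono Q)
  finally show "card {(a, c) \<in> A \<times> A. fraternal H r a c} \<le> Suc d * (d\<^sup>2 * d) * card A"
    by (simp add: P_def algebra_simps)
qed

text \<open>Rank the vertices by degeneracy, orient edges towards smaller rank, and properly colour the
  graph enlarged by all fraternal pairs and by all pairs joined by a directed path of length two.
  If \<open>a\<close> and \<open>x\<close> have the same colour on a path \<open>a, b, x\<close>, then the edges at \<open>b\<close> are neither both
  outgoing nor one incoming and one outgoing, so both enter \<open>b\<close>, which has the smallest rank. A two-coloured path \<open>a, b, x, y\<close>
  would require \<open>r b < r x\<close> and \<open>r x < r b\<close>.\<close>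

theorem minor_free_star_colouring:
  assumes M: "simple_graph M"
  shows "\<exists>k. \<forall>H :: 'a ugraph. simple_graph H \<and> minor_free M H \<longrightarrow>
    (\<exists>c. star_colouring H c \<and> (\<forall>v. c v < k))"
proof -
  define d where "d = (2::nat) ^ card (verts M)"
  define k where "k = d + Suc d * (d\<^sup>2 * d) + 2 * d\<^sup>2"
  have "\<exists>c. star_colouring H c \<and> (\<forall>v. c v < Suc k)"
    if H: "simple_graph H" "minor_free M H" for H :: "'a ugraph"
  proof -
    let ?V = "verts H"
    have fV: "finite ?V" using H by (simp add: simple_graph_def)
    have spE: "sparse d ?V (\<lambda>u v. {u, v} \<in> edges H)"
      using minor_free_sparse[OF M H(2,1)] by (simp add: d_def)
    obtain r :: "'a \<Rightarrow> nat" where r: "inj_on r ?V"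
      "\<And>v. v \<in> ?V \<Longrightarrow> card {u \<in> ?V. {v, u} \<in> edges H \<and> r u < r v} \<le> d"
      using sparse_ranking[OF fV spE] by auto
    define out where "out v = {u \<in> ?V. {v, u} \<in> edges H \<and> r u < r v}" for v
    have outV: "out v \<subseteq> ?V" "finite (out v)" for v using fV by (auto simp: out_def)
    define T where "T x z \<longleftrightarrow> x \<noteq> z \<and> (\<exists>y\<in>out x. z \<in> out y)" for x z
    have "card {z \<in> ?V. T x z} \<le> d\<^sup>2" if x: "x \<in> ?V" for x
    proof -
      have "card {z \<in> ?V. T x z} \<le> card (\<Union>y\<in>out x. out y)"
        using outV by (intro card_mono) (auto simp: T_def)
      also have "\<dots> \<le> (\<Sum>y\<in>out x. card (out y))" by (intro card_UN_le outV)
      also have "\<dots> \<le> (\<Sum>y\<in>out x. d)" using r(2) outV(1)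
        by (intro sum_mono) (auto simp: out_def)
      also have "\<dots> \<le> d * d" using r(2)[OF x] by (simp add: out_def)
      finally show ?thesis by (simp add: power2_eq_square)
    qed
    then have spT: "sparse (2 * d\<^sup>2) ?V (\<lambda>x z. T x z \<or> T z x)"
      by (intro sparse_bounded_outdegree fV)
    have spF: "sparse (Suc d * (d\<^sup>2 * d)) ?V (fraternal H r)"
      using fraternal_sparse[OF M H(2,1) d_def r(2)] by simp
    define R where "R u v \<longleftrightarrow> ({u, v} \<in> edges H \<or> fraternal H r u v) \<or> (T u v \<or> T v u)" for u v
    have "sparse k ?V R" unfolding R_def k_def
      by (intro sparse_union fV spE spF spT)
    moreover have "R v u" if "R u v" for u v
      using that by (auto simp: R_def insert_commute fraternal_def)
    moreover have "\<not> R u u" for u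
      using simple_no_loop[OF H(1)] by (auto simp: R_def fraternal_def T_def)
    ultimately obtain c :: "'a \<Rightarrow> nat" where c: "\<And>v. c v \<le> k"
      "\<And>u v. u \<in> ?V \<Longrightarrow> v \<in> ?V \<Longrightarrow> R u v \<Longrightarrow> c u \<noteq> c v"
      using sparse_colouring[OF fV, of k R] by blast
    have proper: "c u \<noteq> c v" if "{u, v} \<in> edges H" for u v
      using c(2)[of u v] simple_edgeD[OF H(1) that] that by (auto simp: R_def)
    have middle: "r b < r a \<and> r b < r x"
      if e: "{a, b} \<in> edges H" "{b, x} \<in> edges H" and ne: "a \<noteq> x" and ceq: "c a = c x" for a b x
    proof -
      note ab = simple_edgeD[OF H(1) e(1)] and bx = simple_edgeD[OF H(1) e(2)]
      have nR: "\<not> R a x" using c(2)[OF ab(1) bx(2)] ceq by blast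
      have neq: "r a \<noteq> r b" "r b \<noteq> r x" using r(1) ab bx by (auto simp: inj_on_def)
      have sy: "{b, a} \<in> edges H" "{x, b} \<in> edges H" using e by (simp_all add: insert_commute)
      have "\<not> (r a < r b \<and> r x < r b)"
        using nR ne e sy by (auto simp: R_def fraternal_def)
      moreover have "\<not> (r a < r b \<and> r b < r x)"
      proof
        assume "r a < r b \<and> r b < r x"
        then have "T x a" using e sy ab bx ne by (auto simp: T_def out_def)
        then show False using nR by (simp add: R_def)
      qed
      moreover have "\<not> (r x < r b \<and> r b < r a)"
      proof
        assume "r x < r b \<and> r b < r a"
        then have "T a x" using e sy ab bx ne by (auto simp: T_def out_def)
        then show False using nR by (simp add: R_def)
      qed
      ultimately show ?thesis using neq by linarith
    qed
    have "star_colouring H c" unfolding star_colouring_def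
    proof (intro conjI allI impI)
      fix a b x y
      assume *: "{a, b} \<in> edges H \<and> {b, x} \<in> edges H \<and> {x, y} \<in> edges H \<and> a \<noteq> x \<and> b \<noteq> y"
      show "c a \<noteq> c x \<or> c b \<noteq> c y"
        using middle[of a b x] middle[of b x y] * by force
    qed (use proper in blast)
    then show ?thesis using c(1) by (metis le_imp_less_Suc)
  qed
  then show ?thesis by blast
qed

section \<open>Covers as lists of subgraphs\<close>

lemma simple_image_graph:
  assumes "simple_graph G" "inj_on \<phi> (verts G)"
  shows "simple_graph (image_graph \<phi> G)"
proof -
  have "\<phi> ` e \<subseteq> \<phi> ` verts G \<and> card (\<phi> ` e) = 2" if "e \<in> edges G" for e
    using assms that by (metis card_image image_mono inj_on_subset simple_graph_def)
  then show ?thesis using assms(1) by (auto simp: simple_graph_def image_graph_def)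
qed

lemma graph_class_simple: "graph_class C \<Longrightarrow> G \<in> C \<Longrightarrow> simple_graph G"
  unfolding graph_class_def by blast

lemma graph_class_iso: "graph_class C \<Longrightarrow> G \<in> C \<Longrightarrow> simple_graph G' \<Longrightarrow> iso_via \<phi> G G' \<Longrightarrow> G' \<in> C"
  unfolding graph_class_def isomorphic_def by blast

lemma graph_classI:
  assumes "\<And>G. G \<in> C \<Longrightarrow> simple_graph G"
    and "\<And>G G' \<phi>. G \<in> C \<Longrightarrow> simple_graph G' \<Longrightarrow> iso_via \<phi> G G' \<Longrightarrow> G' \<in> C"
  shows "graph_class C"
  using assms unfolding graph_class_def isomorphic_def by blast

text \<open>Since graph classes are closed under isomorphism, the guests of an injective cover can be
  replaced by their images in \<open>H\<close>. A cover is then simply a list of subgraphs, and it is induced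
  exactly if these subgraphs are induced.\<close>

definition subgraph_cover :: "nat ugraph set \<Rightarrow> nat ugraph \<Rightarrow> nat ugraph list \<Rightarrow> bool" where
  "subgraph_cover \<G> H Ks \<longleftrightarrow> (\<forall>K\<in>set Ks. K \<in> \<G> \<and> subgraph K H) \<and> edges H = (\<Union>K\<in>set Ks. edges K)"

lemma subgraph_cover_of_injective_cover:
  assumes cl: "graph_class \<G>" and c: "cover \<G> H Gs \<phi>" "injective_cover Gs \<phi>"
  defines "Ks \<equiv> map (\<lambda>i. image_graph (\<lambda>v. \<phi> (i, v)) (Gs ! i)) [0..<length Gs]"
  shows "subgraph_cover \<G> H Ks"
    and "induced_cover H Gs \<phi> \<Longrightarrow> \<forall>K\<in>set Ks. induced_subgraph K H"
proof -
  let ?im = "\<lambda>i. image_graph (\<lambda>v. \<phi> (i, v)) (Gs ! i)"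
  have Ks: "set Ks = ?im ` {..<length Gs}" by (auto simp: Ks_def)
  have hom: "\<phi> ` verts (disjoint_union Gs) \<subseteq> verts H"
    "\<And>e. e \<in> edges (disjoint_union Gs) \<Longrightarrow> \<phi> ` e \<in> edges H"
    using c(1) by (auto simp: cover_def graph_hom_def)
  have im: "?im i \<in> \<G>" "subgraph (?im i) H" if i: "i < length Gs" for i
  proof -
    have G: "Gs ! i \<in> \<G>" using i c(1) by (auto simp: cover_def)
    have iso: "iso_via (\<lambda>v. \<phi> (i, v)) (Gs ! i) (?im i)"
      using c(2) i by (auto simp: injective_cover_def)
    then have inj: "inj_on (\<lambda>v. \<phi> (i, v)) (verts (Gs ! i))"
      by (auto simp: iso_via_def bij_betw_def)
    have s: "simple_graph (?im i)"
      using simple_image_graph[OF graph_class_simple[OF cl G] inj] .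
    then show "?im i \<in> \<G>" by (rule graph_class_iso[OF cl G _ iso])
    have "edges (?im i) \<subseteq> edges H"
    proof
      fix e assume "e \<in> edges (?im i)"
      then obtain e' where e': "e' \<in> edges (Gs ! i)" "e = (\<lambda>v. \<phi> (i, v)) ` e'"
        by (auto simp: image_graph_def)
      then have "Pair i ` e' \<in> edges (disjoint_union Gs)" using i by (auto simp: disjoint_union_def)
      from hom(2)[OF this] show "e \<in> edges H" using e'(2) by (simp add: image_image)
    qed
    moreover have "verts (?im i) \<subseteq> verts H"
      using hom(1) i by (auto simp: image_graph_def disjoint_union_def)
    ultimately show "subgraph (?im i) H" using s by (simp add: subgraph_def)
  qed
  have "e \<in> (\<Union>K\<in>set Ks. edges K)" if "e \<in> edges H" for e
  proof -
    from that c(1) obtain e' where e': "e' \<in> edges (disjoint_union Gs)" "e = \<phi> ` e'"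
      by (auto simp: cover_def)
    then obtain i d where "e' = Pair i ` d" "i < length Gs" "d \<in> edges (Gs ! i)"
      by (auto simp: disjoint_union_def)
    then show ?thesis using e'(2) unfolding Ks by (auto simp: image_graph_def image_image)
  qed
  moreover have K: "K \<in> \<G> \<and> subgraph K H" if "K \<in> set Ks" for K
    using that im unfolding Ks by blast
  moreover have "edges K \<subseteq> edges H" if "K \<in> set Ks" for K
    using K[OF that] by (simp add: subgraph_def)
  ultimately show "subgraph_cover \<G> H Ks"
    unfolding subgraph_cover_def by blast
  show "\<forall>K\<in>set Ks. induced_subgraph K H" if "induced_cover H Gs \<phi>"
    using that by (auto simp: induced_cover_def Ks)
qed

lemma injective_cover_of_subgraph_cover:
  assumes "subgraph_cover \<G> H Ks"
  shows "cover \<G> H Ks snd \<and> injective_cover Ks snd \<and>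
    ((\<forall>K\<in>set Ks. induced_subgraph K H) \<longrightarrow> induced_cover H Ks snd)"
proof -
  have im: "image_graph (\<lambda>v. snd (i, v)) K = K" for i :: nat and K :: "nat ugraph"
    by (simp add: image_graph_def)
  have K: "K \<in> \<G>" "verts K \<subseteq> verts H" "edges K \<subseteq> edges H" if "K \<in> set Ks" for K
    using assms that by (auto simp: subgraph_cover_def subgraph_def)
  have "\<exists>e'\<in>edges (disjoint_union Ks). e = snd ` e'" if "e \<in> edges H" for e
  proof -
    from that assms obtain i where i: "i < length Ks" "e \<in> edges (Ks ! i)"
      by (auto simp: subgraph_cover_def in_set_conv_nth)
    then show ?thesis
      by (intro bexI[of _ "Pair i ` e"]) (auto simp: disjoint_union_def image_image)
  qed
  moreover have "snd ` e \<in> edges H" if "e \<in> edges (disjoint_union Ks)" for e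
    using that K(3) nth_mem by (fastforce simp: disjoint_union_def image_image)
  moreover have "snd ` verts (disjoint_union Ks) \<subseteq> verts H"
    using K(2) nth_mem by (fastforce simp: disjoint_union_def)
  ultimately have "cover \<G> H Ks snd"
    using K(1) by (auto simp: cover_def graph_hom_def)
  moreover have "injective_cover Ks snd"
    unfolding injective_cover_def im by (simp add: iso_via_def bij_betw_def)
  moreover have "induced_cover H Ks snd" if "\<forall>K\<in>set Ks. induced_subgraph K H"
    using that unfolding induced_cover_def im by simp
  ultimately show ?thesis by blast
qed

lemma Inf_enat_le_iff:
  fixes P :: "'b list \<Rightarrow> bool"
  shows "Inf {enat (length x) | x. P x} \<le> enat n \<longleftrightarrow> (\<exists>x. P x \<and> length x \<le> n)"
    (is "Inf ?S \<le> _ \<longleftrightarrow> _")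
proof
  assume le: "Inf ?S \<le> enat n"
  have "?S \<noteq> {}"
  proof
    assume "?S = {}"
    then have "Inf ?S = \<infinity>" by (simp add: Inf_enat_def)
    then show False using le by simp
  qed
  then obtain y where "y \<in> ?S" by blast
  then have "(LEAST y. y \<in> ?S) \<in> ?S" by (rule LeastI)
  then have "Inf ?S \<in> ?S" using \<open>?S \<noteq> {}\<close> by (simp only: Inf_enat_def if_False)
  then obtain x where "P x" "Inf ?S = enat (length x)" by auto
  then show "\<exists>x. P x \<and> length x \<le> n" using le by auto
next
  assume "\<exists>x. P x \<and> length x \<le> n"
  then obtain x where "P x" "length x \<le> n" by blast
  then have "Inf ?S \<le> enat (length x)" by (intro Inf_lower) auto
  then show "Inf ?S \<le> enat n" using \<open>length x \<le> n\<close> by (meson enat_ord_simps(1) order_trans)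
qed

lemma cg_le_iff:
  assumes "graph_class \<G>"
  shows "cg \<G> H \<le> enat n \<longleftrightarrow> (\<exists>Ks. subgraph_cover \<G> H Ks \<and> length Ks \<le> n)"
proof -
  have "cg \<G> H \<le> enat n \<longleftrightarrow> (\<exists>Gs. (\<exists>\<phi>. cover \<G> H Gs \<phi> \<and> injective_cover Gs \<phi>) \<and> length Gs \<le> n)"
    unfolding cg_def by (rule Inf_enat_le_iff)
  also have "\<dots> \<longleftrightarrow> (\<exists>Ks. subgraph_cover \<G> H Ks \<and> length Ks \<le> n)" (is "?L \<longleftrightarrow> ?R")
  proof
    assume ?L
    then obtain Gs \<phi> where *: "cover \<G> H Gs \<phi>" "injective_cover Gs \<phi>" "length Gs \<le> n" by blast
    show ?R by (rule exI, rule conjI, rule subgraph_cover_of_injective_cover(1)[OF assms *(1,2)])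
      (use *(3) in simp)
  next
    assume ?R
    then show ?L using injective_cover_of_subgraph_cover by blast
  qed
  finally show ?thesis .
qed

lemma icg_le_iff:
  assumes "graph_class \<G>"
  shows "icg \<G> H \<le> enat n \<longleftrightarrow>
    (\<exists>Ks. subgraph_cover \<G> H Ks \<and> (\<forall>K\<in>set Ks. induced_subgraph K H) \<and> length Ks \<le> n)"
proof -
  have "icg \<G> H \<le> enat n \<longleftrightarrow>
      (\<exists>Gs. (\<exists>\<phi>. cover \<G> H Gs \<phi> \<and> injective_cover Gs \<phi> \<and> induced_cover H Gs \<phi>) \<and> length Gs \<le> n)"
    unfolding icg_def by (rule Inf_enat_le_iff)
  also have "\<dots> \<longleftrightarrow>
      (\<exists>Ks. subgraph_cover \<G> H Ks \<and> (\<forall>K\<in>set Ks. induced_subgraph K H) \<and> length Ks \<le> n)"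
    (is "?L \<longleftrightarrow> ?R")
  proof
    assume ?L
    then obtain Gs \<phi> where *: "cover \<G> H Gs \<phi>" "injective_cover Gs \<phi>" "induced_cover H Gs \<phi>"
      "length Gs \<le> n" by blast
    show ?R
      by (rule exI, intro conjI, rule subgraph_cover_of_injective_cover(1)[OF assms *(1,2)],
          rule subgraph_cover_of_injective_cover(2)[OF assms *(1,2,3)]) (use *(4) in simp)
  next
    assume ?R
    then show ?L using injective_cover_of_subgraph_cover by blast
  qed
  finally show ?thesis .
qed

section \<open>Hosts excluding a minor\<close>

text \<open>Vertices with colour \<open>p\<close> or \<open>q\<close> but without a bicoloured \<open>K\<close>-edge are left out on purpose: in \<open>H\<close>
  they could be adjacent to the others.\<close>

definition bicoloured_part :: "('a \<Rightarrow> nat) \<Rightarrow> 'a ugraph \<Rightarrow> nat \<Rightarrow> nat \<Rightarrow> 'a set" where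
  "bicoloured_part c K p q =
     {v. \<exists>w. {v, w} \<in> edges K \<and> (c v = p \<and> c w = q \<or> c v = q \<and> c w = p)}"

text \<open>Suppose that \<open>H\<close> joins two vertices \<open>u\<close>, \<open>v\<close> of the part by an edge missing from \<open>K\<close>. Each of them has a
  \<open>K\<close>-neighbour of the opposite colour, and these neighbours extend the edge to a path on four
  vertices with only the two colours \<open>p\<close> and \<open>q\<close>.\<close>

lemma bicoloured_part_induced:
  assumes sH: "simple_graph H" and H: "star_colouring H c" and K: "subgraph K H"
  shows "induced_subgraph (induce K (bicoloured_part c K p q)) H"
proof -
  let ?S = "bicoloured_part c K p q"
  have sK: "simple_graph K" and EK: "edges K \<subseteq> edges H" and VK: "verts K \<subseteq> verts H"
    using K by (auto simp: subgraph_def)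
  have SV: "?S \<subseteq> verts K" using simple_edgeD[OF sK] by (auto simp: bicoloured_part_def)
  have proper: "c u \<noteq> c v" if "{u, v} \<in> edges H" for u v
    using H that by (auto simp: star_colouring_def)
  have key: "{u, v} \<in> edges K" if uv: "u \<in> ?S" "v \<in> ?S" "{u, v} \<in> edges H" for u v
  proof (rule ccontr)
    assume no: "{u, v} \<notin> edges K"
    obtain w where w: "{u, w} \<in> edges K" "c u = p \<and> c w = q \<or> c u = q \<and> c w = p"
      using uv(1) by (auto simp: bicoloured_part_def)
    obtain z where z: "{v, z} \<in> edges K" "c v = p \<and> c z = q \<or> c v = q \<and> c z = p"
      using uv(2) by (auto simp: bicoloured_part_def)
    have "w \<noteq> v" "u \<noteq> z" using no w(1) z(1) by (auto simp: insert_commute)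
    moreover have "{w, u} \<in> edges H" "{v, z} \<in> edges H"
      using w(1) z(1) EK by (auto simp: insert_commute)
    ultimately have "c w \<noteq> c v \<or> c u \<noteq> c z"
      using H uv(3) unfolding star_colouring_def by blast
    then show False using w(2) z(2) proper[OF uv(3)] by auto
  qed
  have "e \<in> edges K" if e: "e \<in> edges H" "e \<subseteq> ?S" for e
    using simple_edgeE[OF sH e(1)] e key by (metis insert_subset)
  then show ?thesis
    using EK SV VK by (auto simp: induced_subgraph_def induce_def)
qed

text \<open>Every guest of an optimal cover is replaced by its parts for the \<open>k * k\<close> ordered colour pairs.
  Each edge survives in the part of its own two colours, and heredity of \<open>\<G>\<close> keeps the parts in
  the class.\<close>

theorem minor_free_icg_cg_bounded:
  assumes \<G>: "graph_class \<G>" "hereditary \<G>" and \<H>: "graph_class \<H>"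
    and M: "simple_graph M" "\<And>H. H \<in> \<H> \<Longrightarrow> minor_free M H"
  shows "icg_cg_bounded \<G> \<H>"
proof -
  obtain k where k: "\<And>H :: nat ugraph. simple_graph H \<Longrightarrow> minor_free M H \<Longrightarrow>
      \<exists>c. star_colouring H c \<and> (\<forall>v. c v < k)"
    using minor_free_star_colouring[OF M(1)] by blast
  have "icg \<G> H \<le> enat (t * (k * k))" if H: "H \<in> \<H>" and t: "cg \<G> H = enat t" for H t
  proof -
    have sH: "simple_graph H" using graph_class_simple[OF \<H> H] .
    obtain c where c: "star_colouring H c" "\<And>v. c v < k" using k[OF sH M(2)[OF H]] by blast
    obtain Ks where Ks: "subgraph_cover \<G> H Ks" "length Ks \<le> t"
      using cg_le_iff[OF \<G>(1), of H t] t by auto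
    define part where "part K pq = induce K (bicoloured_part c K (fst pq) (snd pq))" for K pq
    define Ls where "Ls = map (\<lambda>(K, pq). part K pq) (List.product Ks (List.product [0..<k] [0..<k]))"
    have L: "\<exists>K\<in>set Ks. \<exists>pq. L = part K pq" if "L \<in> set Ls" for L
      using that by (auto simp: Ls_def)
    have ind: "part K pq \<in> \<G>" "subgraph (part K pq) H" "induced_subgraph (part K pq) H"
      if "K \<in> set Ks" for K pq
    proof -
      have K: "K \<in> \<G>" "subgraph K H" using Ks(1) that by (auto simp: subgraph_cover_def)
      have sK: "simple_graph K" using K(2) by (simp add: subgraph_def)
      have S: "bicoloured_part c K (fst pq) (snd pq) \<subseteq> verts K"
        using simple_edgeD[OF sK] by (auto simp: bicoloured_part_def)
      have "induced_subgraph (part K pq) K"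
        using S by (simp add: part_def induced_subgraph_def induce_def)
      then show "part K pq \<in> \<G>" using \<G>(2) K(1) unfolding hereditary_def by blast
      show "subgraph (part K pq) H"
        using subgraph_induce[OF sK S] K(2) by (auto simp: part_def subgraph_def)
      show "induced_subgraph (part K pq) H"
        unfolding part_def by (rule bicoloured_part_induced[OF sH c(1) K(2)])
    qed
    have "e \<in> (\<Union>L\<in>set Ls. edges L)" if e: "e \<in> edges H" for e
    proof -
      obtain K where K: "K \<in> set Ks" "e \<in> edges K" using Ks(1) e by (auto simp: subgraph_cover_def)
      then have sK: "simple_graph K" using Ks(1) by (auto simp: subgraph_cover_def subgraph_def)
      obtain u v where uv: "e = {u, v}" using simple_edgeE[OF sK K(2)] by metis
      then have "{u, v} \<in> edges K" "{v, u} \<in> edges K" using K(2) by (simp_all add: insert_commute)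
      then have "e \<in> edges (part K (c u, c v))"
        using uv by (auto simp: part_def induce_def bicoloured_part_def)
      moreover have "part K (c u, c v) \<in> set Ls"
        using K(1) c(2) by (force simp: Ls_def)
      ultimately show ?thesis by blast
    qed
    moreover have "edges L \<subseteq> edges H" if "L \<in> set Ls" for L
      using L[OF that] ind(2) unfolding subgraph_def by blast
    ultimately have "edges H = (\<Union>L\<in>set Ls. edges L)" by blast
    moreover have part: "L \<in> \<G> \<and> subgraph L H \<and> induced_subgraph L H" if "L \<in> set Ls" for L
      using L[OF that] ind by auto
    ultimately have "subgraph_cover \<G> H Ls" by (simp add: subgraph_cover_def)
    moreover have "\<forall>L\<in>set Ls. induced_subgraph L H" using part by simp
    moreover have "length Ls \<le> t * (k * k)" using Ks(2) by (simp add: Ls_def)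
    ultimately show ?thesis using icg_le_iff[OF \<G>(1)] by blast
  qed
  then show ?thesis
    unfolding icg_cg_bounded_def by (intro exI[of _ "\<lambda>t. t * (k * k)"]) blast
qed

section \<open>Star forests in subdivided complete graphs\<close>

text \<open>Every edge has an endpoint that lies on no other edge. For simple graphs this says that each
  component is a star, and the formula passes to subgraphs and isomorphic copies directly.\<close>

definition star_forest :: "'a ugraph \<Rightarrow> bool" where
  "star_forest G \<longleftrightarrow> (\<forall>e\<in>edges G. \<exists>v\<in>e. \<forall>e'\<in>edges G. v \<in> e' \<longrightarrow> e' = e)"

lemma star_forest_subset: "star_forest G \<Longrightarrow> edges K \<subseteq> edges G \<Longrightarrow> star_forest K"
  unfolding star_forest_def by (metis subset_iff)

text \<open>A leaf of each edge determines the edge.\<close>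

lemma star_forest_card_edges:
  assumes "simple_graph G" "star_forest G"
  shows "card (edges G) \<le> card (verts G)"
proof -
  obtain leaf where leaf: "\<And>e. e \<in> edges G \<Longrightarrow> leaf e \<in> e \<and> (\<forall>e'\<in>edges G. leaf e \<in> e' \<longrightarrow> e' = e)"
    using assms(2) unfolding star_forest_def by metis
  show ?thesis
  proof (rule card_inj_on_le)
    show "inj_on leaf (edges G)" using leaf by (metis inj_onI)
    show "leaf ` edges G \<subseteq> verts G" using leaf assms(1) by (fastforce simp: simple_graph_def)
  qed (use assms(1) in \<open>simp add: simple_graph_def\<close>)
qed

lemma mad_le:
  fixes G :: "'a ugraph"
  assumes G: "simple_graph G" and k: "\<And>K. subgraph K G \<Longrightarrow> card (edges K) \<le> k * card (verts K)"
  shows "mad G \<le> 2 * real k"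
proof (cases "verts G = {}")
  case True
  then show ?thesis by (simp add: mad_def)
next
  case False
  let ?S = "{2 * real (card (edges K)) / real (card (verts K)) | K.
            subgraph K G \<and> card (verts K) \<ge> 1}"
  have fV: "finite (verts G)" using G by (simp add: simple_graph_def)
  have fE: "finite (edges G)"
    using G fV by (auto simp: simple_graph_def intro: finite_subset[of _ "Pow (verts G)"])
  \<comment> \<open>The maximum is only meaningful over a finite set.\<close>
  have "?S \<subseteq> (\<lambda>(a, b). 2 * real a / real b) ` ({..card (edges G)} \<times> {..card (verts G)})"
  proof
    fix x assume "x \<in> ?S"
    then obtain K where K: "x = 2 * real (card (edges K)) / real (card (verts K))" "subgraph K G"
      by blast
    then have "card (edges K) \<le> card (edges G)" "card (verts K) \<le> card (verts G)"
      using fE fV by (auto simp: subgraph_def intro: card_mono)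
    then show "x \<in> (\<lambda>(a, b). 2 * real a / real b) ` ({..card (edges G)} \<times> {..card (verts G)})"
      using K(1) by (intro image_eqI[of _ _ "(card (edges K), card (verts K))"]) auto
  qed
  then have "finite ?S" by (rule finite_subset) simp
  moreover have "?S \<noteq> {}"
  proof -
    have "subgraph G G" "card (verts G) \<ge> 1"
      using G fV False by (auto simp: subgraph_def Suc_le_eq card_gt_0_iff)
    then show ?thesis by blast
  qed
  moreover have "x \<le> 2 * real k" if x: "x \<in> ?S" for x
  proof -
    obtain K where K: "x = 2 * real (card (edges K)) / real (card (verts K))" "subgraph K G"
      "card (verts K) \<ge> 1" using x by blast
    have "real (card (edges K)) \<le> real k * real (card (verts K))"
      using k[OF K(2)] by (metis of_nat_le_iff of_nat_mult)
    then show ?thesis using K(1,3) by (simp add: divide_le_eq)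
  qed
  ultimately have "Max ?S \<le> 2 * real k" by (intro Max.boundedI) auto
  then show ?thesis using False by (simp add: mad_def)
qed

lemma iso_via_edges:
  assumes "simple_graph G" "simple_graph G'" "iso_via \<phi> G G'"
  shows "edges G' = (\<lambda>e. \<phi> ` e) ` edges G"
proof (intro set_eqI iffI)
  fix e assume e: "e \<in> edges G'"
  obtain a b where ab: "e = {a, b}" "a \<in> verts G'" "b \<in> verts G'"
    using simple_edgeE[OF assms(2) e] by metis
  then obtain u v where uv: "u \<in> verts G" "v \<in> verts G" "a = \<phi> u" "b = \<phi> v"
    using assms(3) unfolding iso_via_def bij_betw_def by blast
  then have "{u, v} \<in> edges G" using assms(3) e ab(1) unfolding iso_via_def by blast
  then show "e \<in> (\<lambda>e. \<phi> ` e) ` edges G" using ab(1) uv by (intro image_eqI[of _ _ "{u, v}"]) auto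
next
  fix e assume "e \<in> (\<lambda>e. \<phi> ` e) ` edges G"
  then obtain d where d: "d \<in> edges G" "e = \<phi> ` d" by blast
  obtain u v where "d = {u, v}" "u \<in> verts G" "v \<in> verts G"
    using simple_edgeE[OF assms(1) d(1)] by metis
  then show "e \<in> edges G'" using assms(3) d unfolding iso_via_def by auto
qed

lemma star_forest_image:
  assumes inj: "inj_on \<phi> (\<Union>(edges G))" and G: "star_forest G" and G': "edges G' = (\<lambda>e. \<phi> ` e) ` edges G"
  shows "star_forest G'"
  unfolding star_forest_def
proof (rule ballI)
  fix d' assume "d' \<in> edges G'"
  then obtain e where e: "e \<in> edges G" "d' = \<phi> ` e" unfolding G' by blast
  obtain v where v: "v \<in> e" "\<And>d. d \<in> edges G \<Longrightarrow> v \<in> d \<Longrightarrow> d = e"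
    using G e(1) unfolding star_forest_def by metis
  show "\<exists>a\<in>d'. \<forall>e'\<in>edges G'. a \<in> e' \<longrightarrow> e' = d'"
  proof (intro bexI[of _ "\<phi> v"] ballI impI)
    fix e' assume "e' \<in> edges G'" "\<phi> v \<in> e'"
    then obtain d where d: "d \<in> edges G" "e' = \<phi> ` d" "\<phi> v \<in> \<phi> ` d" unfolding G' by blast
    then obtain w where w: "w \<in> d" "\<phi> w = \<phi> v" by auto
    have wv: "w \<in> \<Union>(edges G)" "v \<in> \<Union>(edges G)" using v(1) w(1) e(1) d(1) by blast+
    have "w = v" using inj_onD[OF inj w(2) wv] .
    then show "e' = d'" using v(2)[OF d(1)] w(1) d(2) e(2) by simp
  qed (use v(1) e(2) in simp)
qed

definition star_forests :: "nat ugraph set" where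
  "star_forests = {G. simple_graph G \<and> star_forest G}"

text \<open>These hosts have global covering number at most two with respect to star forests, by
  definition, and contain the subdivided complete graphs.\<close>

definition two_star_forests :: "nat ugraph set" where
  "two_star_forests = {H. simple_graph H \<and> (\<exists>E E'. edges H = E \<union> E' \<and>
     star_forest \<lparr>verts = verts H, edges = E\<rparr> \<and> star_forest \<lparr>verts = verts H, edges = E'\<rparr>)}"

lemma union_edges_subset: "simple_graph G \<Longrightarrow> \<Union>(edges G) \<subseteq> verts G"
  by (auto simp: simple_graph_def)

lemma graph_class_star_forests: "graph_class star_forests"
proof (rule graph_classI)
  fix G G' :: "nat ugraph" and \<phi> assume G: "G \<in> star_forests" and G': "simple_graph G'" and \<phi>: "iso_via \<phi> G G'"
  have s: "simple_graph G" "star_forest G" using G by (auto simp: star_forests_def)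
  have "inj_on \<phi> (verts G)" using \<phi> by (simp add: iso_via_def bij_betw_def)
  then have "inj_on \<phi> (\<Union>(edges G))" using union_edges_subset[OF s(1)] by (rule inj_on_subset)
  then have "star_forest G'" using s(2) iso_via_edges[OF s(1) G' \<phi>] by (rule star_forest_image)
  then show "G' \<in> star_forests" using G' by (simp add: star_forests_def)
qed (simp add: star_forests_def)

lemma graph_class_two_star_forests: "graph_class two_star_forests"
proof (rule graph_classI)
  fix G G' :: "nat ugraph" and \<phi> assume G: "G \<in> two_star_forests" and G': "simple_graph G'" and \<phi>: "iso_via \<phi> G G'"
  obtain E E' where E: "edges G = E \<union> E'" "star_forest \<lparr>verts = verts G, edges = E\<rparr>"
    "star_forest \<lparr>verts = verts G, edges = E'\<rparr>" and s: "simple_graph G"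
    using G by (auto simp: two_star_forests_def)
  have inj: "inj_on \<phi> (verts G)" using \<phi> by (simp add: iso_via_def bij_betw_def)
  have sf: "star_forest \<lparr>verts = verts G', edges = (\<lambda>e. \<phi> ` e) ` D\<rparr>"
    if D: "star_forest \<lparr>verts = verts G, edges = D\<rparr>" "D \<subseteq> edges G" for D
  proof (rule star_forest_image[OF _ D(1)])
    show "inj_on \<phi> (\<Union>(edges \<lparr>verts = verts G, edges = D\<rparr>))"
      using D(2) union_edges_subset[OF s] by (intro inj_on_subset[OF inj]) auto
  qed simp
  have "edges G' = (\<lambda>e. \<phi> ` e) ` E \<union> (\<lambda>e. \<phi> ` e) ` E'"
    using iso_via_edges[OF s G' \<phi>] E(1) by (simp add: image_Un)
  moreover have "star_forest \<lparr>verts = verts G', edges = (\<lambda>e. \<phi> ` e) ` E\<rparr>"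
    using E(1) by (intro sf E(2)) simp
  moreover have "star_forest \<lparr>verts = verts G', edges = (\<lambda>e. \<phi> ` e) ` E'\<rparr>"
    using E(1) by (intro sf E(3)) simp
  ultimately show "G' \<in> two_star_forests" using G' unfolding two_star_forests_def
    by (intro CollectI conjI exI[of _ "(\<lambda>e. \<phi> ` e) ` E"] exI[of _ "(\<lambda>e. \<phi> ` e) ` E'"])
qed (simp add: two_star_forests_def)

lemma monotone_star_forests: "monotone_class star_forests"
  using star_forest_subset by (auto simp: monotone_class_def star_forests_def subgraph_def)

lemma mad_star_forests: "param_bounded mad star_forests"
proof -
  have "mad G \<le> 2 * real 1" if "G \<in> star_forests" for G
  proof (rule mad_le)
    show "card (edges K) \<le> 1 * card (verts K)" if "subgraph K G" for K
      using that \<open>G \<in> star_forests\<close> star_forest_card_edges[of K] star_forest_subset[of G K]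
      by (auto simp: star_forests_def subgraph_def)
  qed (use that in \<open>simp add: star_forests_def\<close>)
  then show ?thesis by (auto simp: param_bounded_def intro!: bdd_aboveI2)
qed

lemma mad_two_star_forests: "param_bounded mad two_star_forests"
proof -
  have "mad H \<le> 2 * real 2" if H: "H \<in> two_star_forests" for H
  proof (rule mad_le)
    obtain E E' where E: "edges H = E \<union> E'" "star_forest \<lparr>verts = verts H, edges = E\<rparr>"
      "star_forest \<lparr>verts = verts H, edges = E'\<rparr>" using H by (auto simp: two_star_forests_def)
    fix K assume K: "subgraph K H"
    have part: "card (edges K \<inter> D) \<le> card (verts K)"
      if "star_forest \<lparr>verts = verts H, edges = D\<rparr>" for D
    proof -
      let ?K = "\<lparr>verts = verts K, edges = edges K \<inter> D\<rparr>"
      have "simple_graph ?K" using K by (auto simp: subgraph_def simple_graph_def)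
      moreover have "star_forest ?K" by (rule star_forest_subset[OF that]) simp
      ultimately show ?thesis using star_forest_card_edges[of ?K] by simp
    qed
    have "edges K = (edges K \<inter> E) \<union> (edges K \<inter> E')" using K E(1) by (auto simp: subgraph_def)
    then have "card (edges K) \<le> card (edges K \<inter> E) + card (edges K \<inter> E')"
      by (metis card_Un_le)
    then show "card (edges K) \<le> 2 * card (verts K)" using part[OF E(2)] part[OF E(3)] by linarith
  qed (use H in \<open>simp add: two_star_forests_def\<close>)
  then show ?thesis by (auto simp: param_bounded_def intro!: bdd_aboveI2)
qed

lemma cg_two_star_forests:
  assumes "H \<in> two_star_forests"
  shows "cg star_forests H \<le> enat 2"
proof -
  obtain E E' where E: "edges H = E \<union> E'" "star_forest \<lparr>verts = verts H, edges = E\<rparr>"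
    "star_forest \<lparr>verts = verts H, edges = E'\<rparr>" and H: "simple_graph H"
    using assms by (auto simp: two_star_forests_def)
  let ?Ks = "[\<lparr>verts = verts H, edges = E\<rparr>, \<lparr>verts = verts H, edges = E'\<rparr>]"
  have "subgraph_cover star_forests H ?Ks"
    using E H by (auto simp: subgraph_cover_def star_forests_def subgraph_def simple_graph_def)
  moreover have "length ?Ks \<le> 2" by simp
  ultimately show ?thesis using cg_le_iff[OF graph_class_star_forests] by blast
qed

text \<open>The vertex \<open>i\<close> of the complete graph is \<open>2 * i\<close>, and the odd numbers subdivide its edges;
  the vertices \<open>sub i i\<close> are isolated.\<close>

definition sub :: "nat \<Rightarrow> nat \<Rightarrow> nat" where
  "sub i j = Suc (2 * prod_encode (min i j, max i j))"

definition subdivided_complete :: "nat \<Rightarrow> nat ugraph" where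
  "subdivided_complete n = \<lparr>verts = (\<lambda>i. 2 * i) ` {..<n} \<union> (\<lambda>(i, j). sub i j) ` ({..<n} \<times> {..<n}),
     edges = {{2 * i, sub i j} | i j. i < n \<and> j < n \<and> i \<noteq> j}\<rparr>"

lemma sub_commute: "sub i j = sub j i"
  by (simp add: sub_def min.commute max.commute)

lemma sub_eq_iff: "sub i j = sub k l \<longleftrightarrow> (i = k \<and> j = l) \<or> (i = l \<and> j = k)"
  by (auto simp: sub_def min_def max_def split: if_splits)

lemma even_neq_sub: "2 * i \<noteq> sub k l" "sub k l \<noteq> 2 * i"
  unfolding sub_def by presburger+

text \<open>The half-edges at the smaller endpoints form one star forest, those at the larger endpoints
  the other: in each of them the subdivision vertices are leaves.\<close>

lemma subdivided_complete_two_star_forests: "subdivided_complete n \<in> two_star_forests"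
proof -
  let ?E = "{{2 * i, sub i j} | i j. i < n \<and> j < n \<and> i < j}"
  let ?E' = "{{2 * i, sub i j} | i j. i < n \<and> j < n \<and> j < i}"
  have "simple_graph (subdivided_complete n)"
    by (auto simp: simple_graph_def subdivided_complete_def even_neq_sub)
  moreover have "edges (subdivided_complete n) = ?E \<union> ?E'"
    unfolding subdivided_complete_def by (auto simp: neq_iff)
  moreover have "star_forest \<lparr>verts = V, edges = ?E\<rparr>" for V
    unfolding star_forest_def
  proof
    fix e assume "e \<in> edges \<lparr>verts = V, edges = ?E\<rparr>"
    then obtain i j where ij: "e = {2 * i, sub i j}" "i < j" by auto
    show "\<exists>v\<in>e. \<forall>e'\<in>edges \<lparr>verts = V, edges = ?E\<rparr>. v \<in> e' \<longrightarrow> e' = e"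
      using ij by (intro bexI[of _ "sub i j"]) (auto simp: sub_eq_iff even_neq_sub)
  qed
  moreover have "star_forest \<lparr>verts = V, edges = ?E'\<rparr>" for V
    unfolding star_forest_def
  proof
    fix e assume "e \<in> edges \<lparr>verts = V, edges = ?E'\<rparr>"
    then obtain i j where ij: "e = {2 * i, sub i j}" "j < i" by auto
    show "\<exists>v\<in>e. \<forall>e'\<in>edges \<lparr>verts = V, edges = ?E'\<rparr>. v \<in> e' \<longrightarrow> e' = e"
      using ij by (intro bexI[of _ "sub i j"]) (auto simp: sub_eq_iff even_neq_sub)
  qed
  ultimately show ?thesis unfolding two_star_forests_def
    by (intro CollectI conjI exI[of _ ?E] exI[of _ ?E'])
qed

text \<open>If there are many branch vertices, then more than \<open>k + 1\<close> of them lie in exactly the same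
  members of an induced cover of size \<open>k\<close>. Fix such a vertex \<open>a\<close>. For every other one, \<open>b\<close>, the
  member that covers the edge from \<open>a\<close> to the subdivision vertex of \<open>a\<close> and \<open>b\<close> also contains \<open>b\<close>, and by
  inducedness the whole path from \<open>a\<close> to \<open>b\<close>. Some member serves two vertices \<open>b\<close> and \<open>b'\<close>, and so
  contains a path on five vertices with \<open>a\<close> in the middle: it is not a star forest.\<close>

lemma icg_subdivided_complete:
  assumes "icg star_forests (subdivided_complete n) \<le> enat k"
  shows "n \<le> 2 ^ k * Suc k"
proof (rule ccontr)
  let ?H = "subdivided_complete n"
  assume n: "\<not> n \<le> 2 ^ k * Suc k"
  obtain Ks where Ks: "subgraph_cover star_forests ?H Ks" "\<And>K. K \<in> set Ks \<Longrightarrow> induced_subgraph K ?H"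
    "length Ks \<le> k" using assms icg_le_iff[OF graph_class_star_forests] by blast
  have cK: "card (set Ks) \<le> k" using Ks(3) card_length le_trans by blast
  define T where "T i = {K \<in> set Ks. 2 * i \<in> verts K}" for i
  have "\<exists>X\<in>Pow (set Ks). Suc k < card {i \<in> {..<n}. T i = X}"
  proof (rule ccontr)
    assume "\<not> ?thesis"
    then have small: "card {i \<in> {..<n}. T i = X} \<le> Suc k" if "X \<in> Pow (set Ks)" for X
      using that by (meson not_less)
    have "T i \<in> Pow (set Ks)" for i by (auto simp: T_def)
    then have "{..<n} = (\<Union>X\<in>Pow (set Ks). {i \<in> {..<n}. T i = X})" by blast
    then have "card {..<n} \<le> (\<Sum>X\<in>Pow (set Ks). card {i \<in> {..<n}. T i = X})"
      using card_UN_le[of "Pow (set Ks)" "\<lambda>X. {i \<in> {..<n}. T i = X}"]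
      by (metis finite_Pow_iff finite_set)
    also have "\<dots> \<le> (\<Sum>X\<in>Pow (set Ks). Suc k)" by (intro sum_mono small)
    also have "\<dots> = 2 ^ card (set Ks) * Suc k" by (simp only: sum_constant card_Pow finite_set of_nat_id)
    also have "\<dots> \<le> 2 ^ k * Suc k" using cK by (intro mult_right_mono power_increasing) auto
    finally show False using n by simp
  qed
  then obtain X where X: "Suc k < card {i \<in> {..<n}. T i = X}" by blast
  define Y where "Y = {i \<in> {..<n}. T i = X}"
  have fY: "finite Y" by (simp add: Y_def)
  have cY: "Suc k < card Y" using X by (simp only: Y_def)
  then have "Y \<noteq> {}" by (metis card.empty not_less_zero)
  then obtain a where a: "a \<in> Y" by blast
  have "\<exists>K\<in>set Ks. {2 * a, sub a j} \<in> edges K" if "j \<in> Y - {a}" for j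
  proof -
    have "{2 * a, sub a j} \<in> edges ?H" using that a by (auto simp: Y_def subdivided_complete_def)
    then show ?thesis using Ks(1) by (auto simp: subgraph_cover_def)
  qed
  then obtain g where g: "\<And>j. j \<in> Y - {a} \<Longrightarrow> g j \<in> set Ks \<and> {2 * a, sub a j} \<in> edges (g j)"
    by metis
  have "card (g ` (Y - {a})) \<le> k"
    using g cK by (intro order_trans[OF card_mono cK]) auto
  also have "k < card (Y - {a})" using cY a fY by simp
  finally have "\<not> inj_on g (Y - {a})" using card_image by fastforce
  then obtain b b' where b: "b \<in> Y - {a}" "b' \<in> Y - {a}" "b \<noteq> b'" "g b = g b'"
    by (auto simp: inj_on_def)
  let ?K = "g b"
  have K: "?K \<in> set Ks" "{2 * a, sub a b} \<in> edges ?K" "{2 * a, sub a b'} \<in> edges ?K"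
    using g[OF b(1)] g[OF b(2)] b(4) by auto
  have sK: "simple_graph ?K" "star_forest ?K"
    using Ks(1) K(1) by (auto simp: subgraph_cover_def star_forests_def)
  note v = simple_edgeD[OF sK(1) K(2)]
  have "T a = T b" using a b(1) by (simp add: Y_def)
  then have "2 * b \<in> verts ?K" using v(1) K(1) by (auto simp: T_def)
  moreover have "{2 * b, sub b a} \<in> edges ?H"
    using a b(1) by (auto simp: Y_def subdivided_complete_def)
  moreover have "edges ?K = {e \<in> edges ?H. e \<subseteq> verts ?K}"
    using Ks(2)[OF K(1)] unfolding induced_subgraph_def induce_def
    by (metis select_convs(2))
  ultimately have e: "{2 * b, sub a b} \<in> edges ?K" using v(2) by (simp add: sub_commute)
  obtain x where x: "x \<in> {2 * a, sub a b}"
      "\<And>e'. e' \<in> edges ?K \<Longrightarrow> x \<in> e' \<Longrightarrow> e' = {2 * a, sub a b}"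
    using bspec[OF sK(2)[unfolded star_forest_def] K(2)] by metis
  show False
  proof (cases "x = 2 * a")
    case True
    then have "{2 * a, sub a b'} = {2 * a, sub a b}" using x(2)[OF K(3)] by simp
    then show False using b by (auto simp: doubleton_eq_iff sub_eq_iff)
  next
    case False
    then have "{2 * b, sub a b} = {2 * a, sub a b}" using x(1) x(2)[OF e] by simp
    then show False using b(1) by (auto simp: doubleton_eq_iff)
  qed
qed

theorem star_forests_not_bounded: "\<not> icg_cg_bounded star_forests two_star_forests"
proof
  assume "icg_cg_bounded star_forests two_star_forests"
  then obtain f where f: "\<And>H t. H \<in> two_star_forests \<Longrightarrow> cg star_forests H = enat t \<Longrightarrow>
      icg star_forests H \<le> enat (f t)" unfolding icg_cg_bounded_def by blast
  \<comment> \<open>The covering number of the host is only known to be at most two, so \<open>k\<close> has to dominate three values.\<close>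
  define k where "k = Max (f ` {..2})"
  define H where "H = subdivided_complete (Suc (2 ^ k * Suc k))"
  have H: "H \<in> two_star_forests" unfolding H_def by (rule subdivided_complete_two_star_forests)
  obtain t where t: "cg star_forests H = enat t" "t \<le> 2"
    using cg_two_star_forests[OF H] by (cases "cg star_forests H") auto
  have "f t \<le> k" unfolding k_def using t(2) by (intro Max_ge) auto
  then have "icg star_forests H \<le> enat k"
    using f[OF H t(1)] by (meson enat_ord_simps(1) order_trans)
  then show False using icg_subdivided_complete unfolding H_def by fastforce
qed

section \<open>Triangles covered by paths\<close>

text \<open>Two paths cover a triangle, but the only induced subgraph of a triangle on three vertices is the
  triangle itself, so no induced cover exists at all.\<close>

definition three_vertex_paths :: "nat ugraph set" where
  "three_vertex_paths = {\<lparr>verts = {a, b, c}, edges = {{a, b}, {b, c}}\<rparr> | a b c.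
     a \<noteq> b \<and> b \<noteq> c \<and> a \<noteq> c}"

definition triangles :: "nat ugraph set" where
  "triangles = {\<lparr>verts = {a, b, c}, edges = {{a, b}, {b, c}, {a, c}}\<rparr> | a b c.
     a \<noteq> b \<and> b \<noteq> c \<and> a \<noteq> c}"

lemma graph_class_three_vertex_paths: "graph_class three_vertex_paths"
proof (rule graph_classI)
  show s: "simple_graph G" if "G \<in> three_vertex_paths" for G
    using that by (auto simp: three_vertex_paths_def simple_graph_def)
  fix G G' :: "nat ugraph" and \<phi> assume G: "G \<in> three_vertex_paths" and G': "simple_graph G'" and \<phi>: "iso_via \<phi> G G'"
  obtain a b c where G_eq: "G = \<lparr>verts = {a, b, c}, edges = {{a, b}, {b, c}}\<rparr>"
    "a \<noteq> b" "b \<noteq> c" "a \<noteq> c" using G by (auto simp: three_vertex_paths_def)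
  have "edges G' = {{\<phi> a, \<phi> b}, {\<phi> b, \<phi> c}}"
    using iso_via_edges[OF s[OF G] G' \<phi>] G_eq(1) by simp
  moreover have "verts G' = {\<phi> a, \<phi> b, \<phi> c}" and inj: "inj_on \<phi> {a, b, c}"
    using \<phi> G_eq(1) by (auto simp: iso_via_def bij_betw_def)
  ultimately have "G' = \<lparr>verts = {\<phi> a, \<phi> b, \<phi> c}, edges = {{\<phi> a, \<phi> b}, {\<phi> b, \<phi> c}}\<rparr>" by simp
  moreover have "\<phi> a \<noteq> \<phi> b" "\<phi> b \<noteq> \<phi> c" "\<phi> a \<noteq> \<phi> c"
    using inj G_eq(2-) by (auto simp: inj_on_def)
  ultimately show "G' \<in> three_vertex_paths" unfolding three_vertex_paths_def by blast
qed

lemma graph_class_triangles: "graph_class triangles"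
proof (rule graph_classI)
  show s: "simple_graph G" if "G \<in> triangles" for G
    using that by (auto simp: triangles_def simple_graph_def)
  fix G G' :: "nat ugraph" and \<phi> assume G: "G \<in> triangles" and G': "simple_graph G'" and \<phi>: "iso_via \<phi> G G'"
  obtain a b c where G_eq: "G = \<lparr>verts = {a, b, c}, edges = {{a, b}, {b, c}, {a, c}}\<rparr>"
    "a \<noteq> b" "b \<noteq> c" "a \<noteq> c" using G by (auto simp: triangles_def)
  have "edges G' = {{\<phi> a, \<phi> b}, {\<phi> b, \<phi> c}, {\<phi> a, \<phi> c}}"
    using iso_via_edges[OF s[OF G] G' \<phi>] G_eq(1) by simp
  moreover have "verts G' = {\<phi> a, \<phi> b, \<phi> c}" and inj: "inj_on \<phi> {a, b, c}"
    using \<phi> G_eq(1) by (auto simp: iso_via_def bij_betw_def)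
  ultimately have "G' = \<lparr>verts = {\<phi> a, \<phi> b, \<phi> c}, edges = {{\<phi> a, \<phi> b}, {\<phi> b, \<phi> c}, {\<phi> a, \<phi> c}}\<rparr>" by simp
  moreover have "\<phi> a \<noteq> \<phi> b" "\<phi> b \<noteq> \<phi> c" "\<phi> a \<noteq> \<phi> c"
    using inj G_eq(2-) by (auto simp: inj_on_def)
  ultimately show "G' \<in> triangles" unfolding triangles_def by blast
qed

lemma component_closed_three_vertex_paths: "component_closed three_vertex_paths"
  unfolding component_closed_def
proof (intro ballI subsetI)
  fix G C assume G: "G \<in> three_vertex_paths" and C: "C \<in> components G"
  obtain a b c where G_eq: "G = \<lparr>verts = {a, b, c}, edges = {{a, b}, {b, c}}\<rparr>"
    using G by (auto simp: three_vertex_paths_def)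
  have b: "reachable G b u" if "u \<in> verts G" for u
  proof -
    have "u = b \<or> {b, u} \<in> edges G" using that by (auto simp: G_eq insert_commute)
    then show ?thesis using reachable_refl reachable_edge by metis
  qed
  then have "reachable G u v" if "u \<in> verts G" "v \<in> verts G" for u v
    using that reachable_trans reachable_sym by metis
  then have "{u \<in> verts G. reachable G v u} = verts G" if "v \<in> verts G" for v
    using that by blast
  then have "C = induce G (verts G)" using C by (auto simp: components_def)
  also have "\<dots> = G" by (auto simp: induce_def G_eq)
  finally show "C \<in> three_vertex_paths" using G by simp
qed

text \<open>The decomposition with a single bag.\<close>

lemma treewidth_le_card:
  fixes G :: "'a ugraph"
  assumes "simple_graph G"
  shows "treewidth G \<le> card (verts G) - 1"
proof -
  define T :: "nat ugraph" where "T = \<lparr>verts = {0}, edges = {}\<rparr>"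
  define X where "X = (\<lambda>_ :: nat. verts G)"
  have "\<not> is_cycle T vs" for vs
  proof
    assume c: "is_cycle T vs"
    then have "card (set vs) \<le> card {0 :: nat}"
      by (intro card_mono) (auto simp: is_cycle_def T_def)
    then show False using c by (simp add: is_cycle_def distinct_card)
  qed
  then have "is_tree T"
    by (auto simp: is_tree_def simple_graph_def connected_graph_def T_def reachable_refl)
  moreover have "connected_graph (induce T {t \<in> verts T. v \<in> X t})" if "v \<in> verts G" for v
    using that by (intro connected_induce_star[of 0]) (auto simp: T_def X_def)
  ultimately have "tree_decomposition G T X"
    using assms by (auto simp: tree_decomposition_def T_def X_def simple_graph_def)
  moreover have "decomposition_width T X = card (verts G) - 1"
    by (simp add: decomposition_width_def T_def X_def)
  ultimately show ?thesis unfolding treewidth_def by (intro Least_le) blast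
qed

lemma treewidth_triangles: "param_bounded treewidth triangles"
proof -
  have "treewidth G \<le> 2" if G: "G \<in> triangles" for G
  proof -
    have "card (verts G) = 3" using G by (auto simp: triangles_def)
    moreover have "simple_graph G" using graph_class_simple[OF graph_class_triangles G] .
    ultimately show ?thesis using treewidth_le_card[of G] by simp
  qed
  then show ?thesis by (auto simp: param_bounded_def intro!: bdd_aboveI2)
qed

theorem triangles_not_bounded: "\<not> icg_cg_bounded three_vertex_paths triangles"
proof
  assume "icg_cg_bounded three_vertex_paths triangles"
  then obtain f where f: "\<And>H t. H \<in> triangles \<Longrightarrow> cg three_vertex_paths H = enat t \<Longrightarrow>
      icg three_vertex_paths H \<le> enat (f t)" unfolding icg_cg_bounded_def by blast
  define H :: "nat ugraph" where "H = \<lparr>verts = {0, 1, 2}, edges = {{0, 1}, {1, 2}, {0, 2}}\<rparr>"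
  have H: "H \<in> triangles" unfolding triangles_def H_def
    by (intro CollectI exI[of _ 0] exI[of _ 1] exI[of _ 2]) simp
  have path: "\<lparr>verts = {a, b, c}, edges = {{a, b}, {b, c}}\<rparr> \<in> three_vertex_paths"
    if "a \<noteq> b" "b \<noteq> c" "a \<noteq> c" for a b c
    using that unfolding three_vertex_paths_def by blast
  let ?Ks = "[\<lparr>verts = {0, 1, 2}, edges = {{0, 1}, {1, 2}}\<rparr>,
    \<lparr>verts = {1, 2, 0}, edges = {{1, 2}, {2, 0}}\<rparr>] :: nat ugraph list"
  have "subgraph_cover three_vertex_paths H ?Ks"
    using path[of 0 1 2] path[of 1 2 0]
    by (auto simp: subgraph_cover_def subgraph_def simple_graph_def H_def insert_commute)
  moreover have "length ?Ks \<le> 2" by simp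
  ultimately have "cg three_vertex_paths H \<le> enat 2"
    using cg_le_iff[OF graph_class_three_vertex_paths] by blast
  then obtain t where "cg three_vertex_paths H = enat t"
    by (cases "cg three_vertex_paths H") auto
  from f[OF H this] obtain Ks where Ks: "subgraph_cover three_vertex_paths H Ks"
    "\<And>K. K \<in> set Ks \<Longrightarrow> induced_subgraph K H"
    using icg_le_iff[OF graph_class_three_vertex_paths] by blast
  have "{0, 1} \<in> edges H" by (simp add: H_def)
  then obtain K where K: "K \<in> set Ks" using Ks(1) by (auto simp: subgraph_cover_def)
  then have KG: "K \<in> three_vertex_paths" using Ks(1) by (auto simp: subgraph_cover_def)
  then have c: "card (verts K) = 3" "card (edges K) \<le> 2"
    by (auto simp: three_vertex_paths_def card_insert_if)
  have "verts K \<subseteq> verts H" "K = induce H (verts K)"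
    using Ks(2)[OF K] by (auto simp: induced_subgraph_def)
  moreover have "verts K = verts H"
    using \<open>verts K \<subseteq> verts H\<close> c(1) by (intro card_subset_eq) (auto simp: H_def)
  ultimately have "edges K = {e \<in> edges H. e \<subseteq> verts H}" by (metis induce_def select_convs(2))
  also have "\<dots> = edges H" by (auto simp: H_def)
  finally have "edges K = {{0, 1}, {1, 2}, {0, 2}}" by (simp add: H_def)
  then have "card (edges K) = 3" by (simp add: doubleton_eq_iff)
  then show False using c(2) by simp
qed

theorem theorem2:
  "(\<forall>\<G> \<H>. graph_class \<G> \<and> graph_class \<H> \<and> hereditary \<G> \<and>
        (\<exists>M :: nat ugraph. simple_graph M \<and> (\<forall>H\<in>\<H>. minor_free M H))
      \<longrightarrow> icg_cg_bounded \<G> \<H>) \<and>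
   (\<exists>\<G> \<H>. graph_class \<G> \<and> graph_class \<H> \<and> monotone_class \<G> \<and>
        param_bounded mad \<G> \<and> param_bounded mad \<H> \<and>
        \<not> icg_cg_bounded \<G> \<H>) \<and>
   (\<exists>\<G> \<H>. graph_class \<G> \<and> graph_class \<H> \<and> component_closed \<G> \<and>
        param_bounded treewidth \<H> \<and>
        \<not> icg_cg_bounded \<G> \<H>)"
proof (intro conjI)
  show "\<forall>\<G> \<H>. graph_class \<G> \<and> graph_class \<H> \<and> hereditary \<G> \<and>
        (\<exists>M :: nat ugraph. simple_graph M \<and> (\<forall>H\<in>\<H>. minor_free M H))
      \<longrightarrow> icg_cg_bounded \<G> \<H>"
    using minor_free_icg_cg_bounded by blast
  show "\<exists>\<G> \<H>. graph_class \<G> \<and> graph_class \<H> \<and> monotone_class \<G> \<and>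
        param_bounded mad \<G> \<and> param_bounded mad \<H> \<and> \<not> icg_cg_bounded \<G> \<H>"
    using graph_class_star_forests graph_class_two_star_forests monotone_star_forests
      mad_star_forests mad_two_star_forests star_forests_not_bounded by blast
  show "\<exists>\<G> \<H>. graph_class \<G> \<and> graph_class \<H> \<and> component_closed \<G> \<and>
        param_bounded treewidth \<H> \<and> \<not> icg_cg_bounded \<G> \<H>"
    using graph_class_three_vertex_paths graph_class_triangles component_closed_three_vertex_paths
      treewidth_triangles triangles_not_bounded by blast
qed

end
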